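(* For every $n\ge 3$ there exists a $C^2$-smooth convex cone $K\subset\mathbb{R}^n$ and a billiard trajectory inside $K$ that has infinitely many reflections in finite time.
   Context: Let $\mathcal{P}=\{x\in\mathbb{R}^n : x^n=1\}$. A $C^2$-smooth convex cone is a set $K=\{tp : p\in\gamma,\ t>0\}\subset\mathbb{R}^n$, where $\gamma\subset\mathcal{P}$ is a $C^2$-smooth, strictly convex, closed (compact without boundary) hypersurface of the hyperplane $\mathcal{P}$ with nondegenerate second fundamental form at every point. The billiard moves inside the convex region bounded by $K$: a point moves with unit speed along straight segments and reflects at $K$ by the law "angle of incidence equals angle of reflection". A billiard trajectory with infinitely many reflections is given by a sequence of reflection points $p_k\in K$, $k\ge 1$, with $p_{k+1}\ne p_k$, such that the open segments $(p_k,p_{k+1})$ lie in the open convex region bounded by $K$ and, with $v_k=\frac{p_{k+1}-p_k}{\|p_{k+1}-p_k\|}$, for every $k\ge 2$ the vector $v_k$ is the reflection of $v_{k-1}$ in the tangent hyperplane $T_{p_k}K$ (that is, $v_k$ and $v_{k-1}$ have the same orthogonal projection to $T_{p_k}K$ and opposite normal components). The infinitely many reflections occur in finite time if $\sum_{k\ge 1}\|p_{k+1}-p_k\|<\infty$. *)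

theory Defs
  imports "HOL-Analysis.Analysis"
begin

definition C2_on :: "('a::real_normed_vector \<Rightarrow> real) \<Rightarrow> 'a set \<Rightarrow> bool" where
  "C2_on f U \<longleftrightarrow>
     (\<exists>(f' :: 'a \<Rightarrow> 'a \<Rightarrow>\<^sub>L real) (f'' :: 'a \<Rightarrow> 'a \<Rightarrow>\<^sub>L 'a \<Rightarrow>\<^sub>L real).
        (\<forall>x\<in>U. (f has_derivative blinfun_apply (f' x)) (at x)) \<and>
        (\<forall>x\<in>U. (f' has_derivative blinfun_apply (f'' x)) (at x)) \<and>
        continuous_on U f'')"

definition coord_hyperplane :: "'n::finite \<Rightarrow> (real^'n) set" where
  "coord_hyperplane l = {x. x $ l = 1}"

definition coord_direction :: "'n::finite \<Rightarrow> (real^'n) set" where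
  "coord_direction l = {v. v $ l = 0}"

(* For a C2 hypersurface M the set of velocities below is the usual tangent space,
   a linear subspace through the origin (not translated to p). *)
definition tangent_space :: "'a::real_normed_vector set \<Rightarrow> 'a \<Rightarrow> 'a set" where
  "tangent_space M p =
     {v. \<exists>c :: real \<Rightarrow> 'a. c 0 = p \<and> (\<forall>\<^sub>F t in at 0. c t \<in> M) \<and>
           (c has_vector_derivative v) (at 0)}"

(* Locally M is a regular level set inside the hyperplane; the derivative of f has to be
   nonzero along the hyperplane, not merely in the ambient space. *)
definition C2_hypersurface_in_hyperplane :: "'n::finite \<Rightarrow> (real^'n) set \<Rightarrow> bool" where
  "C2_hypersurface_in_hyperplane l M \<longleftrightarrow>
     M \<subseteq> coord_hyperplane l \<and>
     (\<forall>p\<in>M. \<exists>U f. open U \<and> p \<in> U \<and> C2_on f U \<and>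
        M \<inter> U = {x \<in> coord_hyperplane l \<inter> U. f x = 0} \<and>
        (\<exists>v\<in>coord_direction l. frechet_derivative f (at p) v \<noteq> 0))"

definition unit_normal_field :: "'n::finite \<Rightarrow> (real^'n) set \<Rightarrow> (real^'n \<Rightarrow> real^'n) \<Rightarrow> bool" where
  "unit_normal_field l M N \<longleftrightarrow>
     (\<forall>x\<in>M. N x \<in> coord_direction l \<and> norm (N x) = 1 \<and> N x \<in> (tangent_space M x)\<^sup>\<bottom>)"

(* B(v,w) = - <dN(v), w> for a unit normal field N of M in the hyperplane.  The derivative
   within M is determined only on tangent vectors, so only the values of B on
   tangent_space M p are meaningful; there B is unique up to the sign of N. *)
definition has_second_fundamental_form ::
    "'n::finite \<Rightarrow> (real^'n) set \<Rightarrow> real^'n \<Rightarrow> (real^'n \<Rightarrow> real^'n \<Rightarrow> real) \<Rightarrow> bool" where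
  "has_second_fundamental_form l M p B \<longleftrightarrow>
     (\<exists>N N'. unit_normal_field l M N \<and> (N has_derivative N') (at p within M) \<and>
        B = (\<lambda>v w. - (N' v \<bullet> w)))"

definition nondegenerate_form_on :: "'a::zero set \<Rightarrow> ('a \<Rightarrow> 'a \<Rightarrow> real) \<Rightarrow> bool" where
  "nondegenerate_form_on T B \<longleftrightarrow> (\<forall>v\<in>T. v \<noteq> 0 \<longrightarrow> (\<exists>w\<in>T. B v w \<noteq> 0))"

(* Boundary, relative to the hyperplane, of a compact strictly convex body of full dimension. *)
definition strictly_convex_closed_in_hyperplane :: "'n::finite \<Rightarrow> (real^'n) set \<Rightarrow> bool" where
  "strictly_convex_closed_in_hyperplane l M \<longleftrightarrow>
     (\<exists>C. compact C \<and> convex C \<and> affine hull C = coord_hyperplane l \<and>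
        (\<forall>x\<in>C. \<forall>y\<in>C. x \<noteq> y \<longrightarrow> open_segment x y \<subseteq> rel_interior C) \<and>
        M = rel_frontier C)"

definition C2_smooth_convex_cone :: "'n::finite \<Rightarrow> (real^'n) set \<Rightarrow> bool" where
  "C2_smooth_convex_cone l K \<longleftrightarrow>
     (\<exists>\<gamma>. C2_hypersurface_in_hyperplane l \<gamma> \<and>
        strictly_convex_closed_in_hyperplane l \<gamma> \<and>
        (\<forall>p\<in>\<gamma>. \<exists>B. has_second_fundamental_form l \<gamma> p B \<and>
                    nondegenerate_form_on (tangent_space \<gamma> p) B) \<and>
        K = {t *\<^sub>R p | t p. p \<in> \<gamma> \<and> t > 0})"

definition is_reflection_in :: "'a::euclidean_space set \<Rightarrow> 'a \<Rightarrow> 'a \<Rightarrow> bool" where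
  "is_reflection_in T v v' \<longleftrightarrow> (\<exists>u\<in>T. \<exists>w\<in>T\<^sup>\<bottom>. v = u + w \<and> v' = u - w)"

definition billiard_velocity :: "(nat \<Rightarrow> 'a::real_normed_vector) \<Rightarrow> nat \<Rightarrow> 'a" where
  "billiard_velocity p k = (p (Suc k) - p k) /\<^sub>R norm (p (Suc k) - p k)"

(* Reflection points are indexed from 0, so p 0 is only a starting point on K and the first
   reflection is at p 1.  The open convex region bounded by a convex cone K (which consists
   of the boundary rays only) is the interior of the convex hull of K. *)
definition billiard_trajectory :: "'a::euclidean_space set \<Rightarrow> (nat \<Rightarrow> 'a) \<Rightarrow> bool" where
  "billiard_trajectory K p \<longleftrightarrow>
     (\<forall>k. p k \<in> K) \<and>
     (\<forall>k. p (Suc k) \<noteq> p k) \<and>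
     (\<forall>k. open_segment (p k) (p (Suc k)) \<subseteq> interior (convex hull K)) \<and>
     (\<forall>k. is_reflection_in (tangent_space K (p (Suc k)))
            (billiard_velocity p k) (billiard_velocity p (Suc k)))"

end

theory Submission
  imports Defs "HOL-Real_Asymp.Real_Asymp"
begin

text \<open>
  Two facts about billiards in a cone reduce the problem to a plane curve. First, every tangent
  hyperplane of a cone passes through the apex, so radial projection to the unit sphere turns a
  billiard trajectory in the cone into one for spherical geometry, and conversely a spherical
  trajectory lifts to the cone as long as its total length stays below \<open>\<pi>/2\<close>: if the reflection
  point number \<open>k\<close> lies at arc length \<open>\<theta>\<^sub>k\<close> along the spherical trajectory and in direction \<open>q\<^sub>k\<close>
  (all \<open>q\<^sub>k\<close> of the same norm), it lifts to \<open>q\<^sub>k / cos \<theta>\<^sub>k\<close>, and the lifted edges have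
  lengths proportional to \<open>tan \<theta>\<^sub>k\<^sub>+\<^sub>1 - tan \<theta>\<^sub>k\<close>. So finite spherical length gives finite time. Second,
  if the body is symmetric in all other coordinates, a trajectory in the space of three
  coordinates \<open>i\<close>, \<open>j\<close>, \<open>l\<close> stays there.

  It remains to find, in the affine plane of these coordinates with \<open>x\<^sub>l = 1\<close>, a convex \<open>C\<^sup>2\<close> curve
  with a spherical billiard trajectory of infinitely many edges and small total length. The vertices
  are chosen first, on the unit circle, at angles \<open>\<phi>\<^sub>0 < \<phi>\<^sub>1 < \<dots>\<close> with summable gaps of order
  \<open>1/k\<^sup>2\<close>. At each vertex the two adjacent edges determine the tangent line that the reflection law
  requires. If neighbouring gaps were equal, the tangent of the circle would do, by symmetry. In
  general the required tangent is tilted by a quantity comparable to the difference of neighbouring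
  gaps, which is of order \<open>1/k\<^sup>3\<close> and hence of smaller order than the gaps themselves. Therefore
  the circle can be bent into the required position by bumps that live on disjoint intervals around the vertices, of
  width comparable to the gap and with slope comparable to the tilt: their second derivatives have the
  order of the tilt divided by the gap, which tends to \<open>0\<close>, so that the sum of the bumps is \<open>C\<^sup>2\<close> even at
  the limit point (\<open>C2_interpolation_of_small_slopes\<close>). As they are also small, the
  curve keeps positive curvature. The third derivatives of the bumps are
  unbounded near the limit point.

  The body is \<open>{x. x\<^sub>l = 1 \<and> |x|\<^sup>2/2 - 1 + g (x\<^sub>j) \<le> 0}\<close> with \<open>g\<close> the sum of the bumps, that is, a
  perturbed unit ball of the hyperplane. Its defining function has a positive definite Hessian,
  which gives strict convexity and nondegeneracy of the second fundamental form
  (\<open>smooth_convex_cone\<close>); the reflection law is \<open>velocity_jump\<close>.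
\<close>

section \<open>A C2 function with prescribed small slopes at a sequence of zeros\<close>

text \<open>Powers of the positive part are differentiable at the origin too; they glue the bump below to
  \<open>0\<close> without case distinctions.\<close>
lemma DERIV_max_0_power:
  fixes s :: real
  assumes "n \<ge> 2"
  shows "((\<lambda>s. max 0 s ^ n) has_real_derivative real n * max 0 s ^ (n - 1)) (at s)"
proof (cases "s = 0")
  case True
  have "((\<lambda>h. max 0 h ^ (n - 1)) \<longlongrightarrow> max 0 0 ^ (n - 1)) (at (0::real))"
    by (intro tendsto_intros)
  moreover have zero: "max 0 0 ^ (n - 1) = (0::real)"
    using assms by (simp add: power_0_left)
  ultimately have lim: "((\<lambda>h. max 0 h ^ (n - 1)) \<longlongrightarrow> 0) (at (0::real))"
    by metis
  have "\<forall>h. h \<noteq> 0 \<longrightarrow> max 0 h ^ (n - 1) = (max 0 (0 + h) ^ n - max 0 0 ^ n) / (h :: real)"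
    using assms by (cases n) (auto simp: max_def power_0_left)
  from iffD1[OF LIM_equal[OF this] lim]
  have "((\<lambda>h. (max 0 (0 + h) ^ n - max 0 0 ^ n) / h) \<longlongrightarrow> 0) (at (0::real))" .
  then show ?thesis unfolding True DERIV_def zero by simp
next
  case False
  show ?thesis
  proof (cases "s > 0")
    case True
    have "((\<lambda>s. s ^ n) has_real_derivative real n * max 0 s ^ (n - 1)) (at s)"
      using True by (auto intro!: derivative_eq_intros)
    then show ?thesis
      by (rule has_field_derivative_transform_within_open[where S = "{0<..}"]) (use True in auto)
  next
    case neg: False
    have "((\<lambda>s. 0) has_real_derivative real n * max 0 s ^ (n - 1)) (at s)"
      using neg False assms by (auto simp: max_def power_0_left)
    then show ?thesis
      by (rule has_field_derivative_transform_within_open[where S = "{..<0}"])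
         (use neg False assms in \<open>auto simp: power_0_left\<close>)
  qed
qed

text \<open>A \<open>C\<^sup>2\<close> function supported on \<open>[-1, 1]\<close> with value \<open>0\<close> and slope \<open>1\<close> at the origin. The cube
  makes two derivatives vanish at the ends of the support.\<close>
definition bump :: "real \<Rightarrow> real" where
  "bump u = u * max 0 (1 - u\<^sup>2) ^ 3"

definition bump' :: "real \<Rightarrow> real" where
  "bump' u = max 0 (1 - u\<^sup>2) ^ 3 - 6 * u\<^sup>2 * max 0 (1 - u\<^sup>2) ^ 2"

definition bump'' :: "real \<Rightarrow> real" where
  "bump'' u = 24 * u ^ 3 * max 0 (1 - u\<^sup>2) - 18 * u * max 0 (1 - u\<^sup>2) ^ 2"

lemma DERIV_bump: "(bump has_real_derivative bump' u) (at u)"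
proof -
  have "((\<lambda>u. max 0 (1 - u\<^sup>2) ^ 3) has_real_derivative
           (real 3 * max 0 (1 - u\<^sup>2) ^ (3 - 1)) * (- 2 * u)) (at u)"
    by (rule DERIV_chain2[OF DERIV_max_0_power]) (auto intro!: derivative_eq_intros)
  from DERIV_mult[OF DERIV_ident this] show ?thesis
    unfolding bump_def[abs_def] bump'_def
    by (rule DERIV_cong) (simp add: algebra_simps power2_eq_square)
qed

lemma DERIV_bump': "(bump' has_real_derivative bump'' u) (at u)"
proof -
  have 3: "((\<lambda>u. max 0 (1 - u\<^sup>2) ^ 3) has_real_derivative
           (real 3 * max 0 (1 - u\<^sup>2) ^ (3 - 1)) * (- 2 * u)) (at u)"
    by (rule DERIV_chain2[OF DERIV_max_0_power]) (auto intro!: derivative_eq_intros)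
  have 2: "((\<lambda>u. max 0 (1 - u\<^sup>2) ^ 2) has_real_derivative
           (real 2 * max 0 (1 - u\<^sup>2) ^ (2 - 1)) * (- 2 * u)) (at u)"
    by (rule DERIV_chain2[OF DERIV_max_0_power]) (auto intro!: derivative_eq_intros)
  have 1: "((\<lambda>u. 6 * u\<^sup>2) has_real_derivative 12 * u) (at u)"
    by (auto intro!: derivative_eq_intros)
  from DERIV_diff[OF 3 DERIV_mult[OF 1 2]] show ?thesis
    unfolding bump'_def[abs_def] bump''_def
    by (rule DERIV_cong) (simp add: algebra_simps power2_eq_square power3_eq_cube)
qed

lemma continuous_on_bump'': "continuous_on A bump''"
  unfolding bump''_def[abs_def] by (intro continuous_intros)

lemma bump_eq_0_outside:
  assumes "\<bar>u\<bar> \<ge> 1"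
  shows "bump u = 0" "bump' u = 0" "bump'' u = 0"
proof -
  have "u\<^sup>2 \<ge> 1" using assms by (metis one_le_power power2_abs)
  then have "max 0 (1 - u\<^sup>2) = 0" by simp
  then show "bump u = 0" "bump' u = 0" "bump'' u = 0"
    by (simp_all add: bump_def bump'_def bump''_def)
qed

lemma bump_at_0: "bump 0 = 0" "bump' 0 = 1"
  by (simp_all add: bump_def bump'_def)

lemma abs_bump_le: "\<bar>bump u\<bar> \<le> 1" "\<bar>bump' u\<bar> \<le> 7" "\<bar>bump'' u\<bar> \<le> 42"
proof -
  define m where "m = max 0 (1 - u\<^sup>2)"
  have "\<bar>bump u\<bar> \<le> 1 \<and> \<bar>bump' u\<bar> \<le> 7 \<and> \<bar>bump'' u\<bar> \<le> 42"
  proof (cases "\<bar>u\<bar> \<ge> 1")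
    case True
    then show ?thesis by (simp add: bump_eq_0_outside)
  next
    case False
    have u: "\<bar>u\<bar> ^ n \<le> 1" for n using False by (intro power_le_one) auto
    have "0 \<le> m" "m \<le> 1" unfolding m_def by auto
    then have m: "\<bar>m ^ n\<bar> \<le> 1" for n by (auto intro: power_le_one)
    have um: "\<bar>u ^ a * m ^ b\<bar> \<le> 1" for a b
      using mult_mono[OF u m] by (simp add: abs_mult power_abs)
    have "\<bar>bump u\<bar> \<le> 1" using um[of 1 3] by (simp add: bump_def m_def)
    moreover have "\<bar>bump' u\<bar> \<le> 7"
      using um[of 0 3, unfolded power_0 mult_1] um[of 2 2] unfolding bump'_def m_def[symmetric] mult.assoc by linarith
    moreover have "\<bar>bump'' u\<bar> \<le> 42"
      using um[of 3 1] um[of 1 2] unfolding bump''_def m_def[symmetric] mult.assoc power_one_right by linarith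
    ultimately show ?thesis by blast
  qed
  then show "\<bar>bump u\<bar> \<le> 1" "\<bar>bump' u\<bar> \<le> 7" "\<bar>bump'' u\<bar> \<le> 42" by auto
qed

text \<open>Where at most one summand is nonzero, the series and all its partial sums are controlled by
  that one summand.\<close>
lemma disjoint_supports_unique:
  fixes f :: "nat \<Rightarrow> real \<Rightarrow> real"
  assumes "\<And>i k. f i t \<noteq> 0 \<Longrightarrow> f k t \<noteq> 0 \<Longrightarrow> i = k"
  obtains k where "\<And>i. i \<noteq> k \<Longrightarrow> f i t = 0" "(\<Sum>i. f i t) = f k t"
                  "\<And>n. (\<Sum>i<n. f i t) = (if k < n then f k t else 0)"
proof -
  obtain k where k: "\<And>i. i \<noteq> k \<Longrightarrow> f i t = 0"
    using assms by metis
  have "(\<Sum>i. f i t) = (\<Sum>i\<in>{k}. f i t)"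
    by (rule suminf_finite) (use k in auto)
  moreover have "(\<Sum>i<n. f i t) = (if k < n then f k t else 0)" for n
  proof -
    have "(\<Sum>i<n. f i t) = (\<Sum>i<n. if i = k then f k t else 0)"
      by (rule sum.cong) (use k in auto)
    then show ?thesis by simp
  qed
  ultimately show ?thesis by (intro that[of k] k) simp_all
qed

text \<open>The second derivatives of the bumps tend to \<open>0\<close> like \<open>1/k\<close>, which is not summable, so the
  Weierstrass M-test does not apply to them. Disjointness of the supports replaces it: the tail of the series is
  at each point a single summand.\<close>
lemma uniform_limit_disjoint_supports:
  fixes f :: "nat \<Rightarrow> real \<Rightarrow> real"
  assumes disj: "\<And>t i k. f i t \<noteq> 0 \<Longrightarrow> f k t \<noteq> 0 \<Longrightarrow> i = k"
    and bound: "\<And>k t. \<bar>f k t\<bar> \<le> e k" and e: "e \<longlonglongrightarrow> 0"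
  shows "uniform_limit UNIV (\<lambda>n t. \<Sum>i<n. f i t) (\<lambda>t. \<Sum>i. f i t) sequentially"
proof (rule uniform_limitI)
  fix \<epsilon> :: real assume "\<epsilon> > 0"
  from LIMSEQ_D[OF e this] obtain n0 where n0: "\<And>k. k \<ge> n0 \<Longrightarrow> \<bar>e k\<bar> < \<epsilon>" by auto
  have "dist (\<Sum>i<n. f i t) (\<Sum>i. f i t) < \<epsilon>" if "n \<ge> n0" for n t
  proof -
    obtain k where k: "(\<Sum>i. f i t) = f k t" "(\<Sum>i<n. f i t) = (if k < n then f k t else 0)"
      using disjoint_supports_unique[of f t] disj by metis
    have "\<bar>f k t\<bar> < \<epsilon>" if "k \<ge> n"
      using bound[of k t] n0[of k] that \<open>n \<ge> n0\<close> by linarith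
    then show ?thesis using k \<open>\<epsilon> > 0\<close> by (auto simp: dist_real_def)
  qed
  then show "\<forall>\<^sub>F n in sequentially. \<forall>t\<in>UNIV. dist (\<Sum>i<n. f i t) (\<Sum>i. f i t) < \<epsilon>"
    unfolding eventually_sequentially by blast
qed

lemma DERIV_suminf_disjoint_supports:
  fixes f f' :: "nat \<Rightarrow> real \<Rightarrow> real"
  assumes disj: "\<And>t i k. f i t \<noteq> 0 \<Longrightarrow> f k t \<noteq> 0 \<Longrightarrow> i = k"
    and disj': "\<And>t i k. f' i t \<noteq> 0 \<Longrightarrow> f' k t \<noteq> 0 \<Longrightarrow> i = k"
    and bound: "\<And>k t. \<bar>f' k t\<bar> \<le> e k" and e: "e \<longlonglongrightarrow> 0"
    and deriv: "\<And>k t. (f k has_real_derivative f' k t) (at t)"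
  shows "((\<lambda>t. \<Sum>i. f i t) has_real_derivative (\<Sum>i. f' i t)) (at t)"
proof -
  obtain k where "\<And>i. i \<noteq> k \<Longrightarrow> f i 0 = 0" using disjoint_supports_unique[of f 0] disj by metis
  then have "summable (\<lambda>i. f i 0)" by (intro summable_finite[of "{k}"]) auto
  then obtain g where "\<And>x. (\<lambda>n. f n x) sums g x \<and> (g has_real_derivative (\<Sum>i. f' i x)) (at x)"
    using has_field_derivative_series[of UNIV f f' "\<lambda>t. \<Sum>i. f' i t" 0]
          uniform_limit_disjoint_supports[OF disj' bound e] deriv by auto
  moreover from this have "g = (\<lambda>t. \<Sum>i. f i t)" by (auto simp: sums_unique)
  ultimately show ?thesis by blast
qed

text \<open>The function is the sum of the bumps \<open>d k * h k * bump ((t - y k) / h k)\<close>, whose supports have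
  disjoint interiors. Its second derivative is bounded near \<open>y k\<close> by a multiple of \<open>d k / h k\<close>; this ratio is at most
  \<open>\<eta> k\<close> and tends to \<open>0\<close>, which is what makes the sum \<open>C\<^sup>2\<close> at the accumulation point of the \<open>y k\<close>.
  The constant \<open>1/100\<close> beats the bound \<open>42\<close> for the second derivative of the bump.\<close>
lemma C2_interpolation_of_small_slopes:
  fixes y h d \<eta> :: "nat \<Rightarrow> real"
  assumes sep: "\<And>k. y k + h k \<le> y (Suc k) - h (Suc k)"
    and h: "\<And>k. h k > 0" "\<And>k. h k \<le> 1"
    and d: "\<And>k. \<bar>d k\<bar> \<le> \<eta> k * h k" and \<eta>: "\<And>k. \<eta> k \<le> 1/100" "\<eta> \<longlonglongrightarrow> 0"
  obtains g g' g'' :: "real \<Rightarrow> real" where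
    "\<And>t. (g has_real_derivative g' t) (at t)"
    "\<And>t. (g' has_real_derivative g'' t) (at t)"
    "continuous_on UNIV g''"
    "\<And>t. \<bar>g t\<bar> \<le> 1/8" "\<And>t. \<bar>g' t\<bar> \<le> 1/4" "\<And>t. \<bar>g'' t\<bar> \<le> 1/2"
    "\<And>k. g (y k) = 0" "\<And>k. g' (y k) = d k"
proof -
  define f where "f k t = d k * h k * bump ((t - y k) / h k)" for k t
  define f' where "f' k t = d k * bump' ((t - y k) / h k)" for k t
  define f'' where "f'' k t = d k / h k * bump'' ((t - y k) / h k)" for k t
  have less: "y i + h i \<le> y k - h k" if "i < k" for i k
    using that
  proof (induction k)
    case (Suc k)
    then show ?case using sep[of k] h(1)[of k] by (cases "i = k") auto
  qed simp
  have near: "\<bar>t - y k\<bar> < h k" if "f k t \<noteq> 0 \<or> f' k t \<noteq> 0 \<or> f'' k t \<noteq> 0" for k t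
  proof (rule ccontr)
    assume "\<not> \<bar>t - y k\<bar> < h k"
    then have "\<bar>(t - y k) / h k\<bar> \<ge> 1" using h(1)[of k] by (simp add: abs_divide)
    then show False using that by (simp add: f_def f'_def f''_def bump_eq_0_outside)
  qed
  have near_unique: "i = k" if "\<bar>t - y i\<bar> < h i" "\<bar>t - y k\<bar> < h k" for i k t
    using that less[of i k] less[of k i] by (cases i k rule: linorder_cases) auto
  have disj: "f i t \<noteq> 0 \<Longrightarrow> f k t \<noteq> 0 \<Longrightarrow> i = k"
    and disj': "f' i t \<noteq> 0 \<Longrightarrow> f' k t \<noteq> 0 \<Longrightarrow> i = k"
    and disj'': "f'' i t \<noteq> 0 \<Longrightarrow> f'' k t \<noteq> 0 \<Longrightarrow> i = k" for i k t
    using near near_unique by meson+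
  have \<eta>_nonneg: "\<eta> k \<ge> 0" for k
  proof -
    have "0 \<le> \<eta> k * h k" using d[of k] by linarith
    then show ?thesis using h(1)[of k] by (simp add: zero_le_mult_iff)
  qed
  have d_le: "\<bar>d k\<bar> \<le> \<eta> k" for k
    using d[of k] mult_left_mono[OF h(2)[of k] \<eta>_nonneg[of k]] by simp
  have dh_le: "\<bar>d k * h k\<bar> \<le> \<eta> k" for k
    using mult_mono[OF d_le[of k] h(2)[of k]] h(1)[of k] \<eta>_nonneg[of k]
    by (simp add: abs_mult)
  have d_h_le: "\<bar>d k / h k\<bar> \<le> \<eta> k" for k
    using d[of k] h(1)[of k] by (simp add: abs_divide pos_divide_le_eq)
  have b: "\<bar>f k t\<bar> \<le> \<eta> k * 1" for k t
    unfolding f_def abs_mult[of "_ * _"] using dh_le abs_bump_le(1) \<eta>_nonneg by (intro mult_mono) auto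
  have b': "\<bar>f' k t\<bar> \<le> \<eta> k * 7" for k t
    unfolding f'_def abs_mult using d_le abs_bump_le(2) \<eta>_nonneg by (intro mult_mono) auto
  have b'': "\<bar>f'' k t\<bar> \<le> \<eta> k * 42" for k t
    unfolding f''_def abs_mult using d_h_le abs_bump_le(3) \<eta>_nonneg by (intro mult_mono) auto
  have lim: "(\<lambda>k. \<eta> k * c) \<longlonglongrightarrow> 0" for c
    using tendsto_mult_left_zero[OF \<eta>(2)] .
  have lin: "((\<lambda>t. (t - y k) / h k) has_real_derivative 1 / h k) (at t)" for k t
    using h(1)[of k] by (auto intro!: derivative_eq_intros)
  have D: "(f k has_real_derivative f' k t) (at t)" for k t
    unfolding f_def[abs_def] f'_def
    by (rule DERIV_cong[OF DERIV_cmult[OF DERIV_chain2[OF DERIV_bump lin]]])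
       (use h(1)[of k] in simp)
  have D': "(f' k has_real_derivative f'' k t) (at t)" for k t
    unfolding f'_def[abs_def] f''_def
    by (rule DERIV_cong[OF DERIV_cmult[OF DERIV_chain2[OF DERIV_bump' lin]]]) (use h(1)[of k] in simp)
  let ?g = "\<lambda>t. \<Sum>i. f i t" and ?g' = "\<lambda>t. \<Sum>i. f' i t" and ?g'' = "\<lambda>t. \<Sum>i. f'' i t"
  show ?thesis
  proof (rule that)
    show "(?g has_real_derivative ?g' t) (at t)" for t
      by (rule DERIV_suminf_disjoint_supports[OF disj disj' b' lim D])
    show "(?g' has_real_derivative ?g'' t) (at t)" for t
      by (rule DERIV_suminf_disjoint_supports[OF disj' disj'' b'' lim D'])
    have "continuous_on UNIV (f'' k)" for k
      unfolding f''_def[abs_def]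
      by (intro continuous_intros continuous_on_compose2[OF continuous_on_bump''[of UNIV]])
         (use h(1)[of k] in auto)
    then have "continuous_on UNIV (\<lambda>t. \<Sum>i<n. f'' i t)" for n
      by (intro continuous_on_sum) auto
    then show "continuous_on UNIV ?g''"
      by (intro uniform_limit_theorem[OF _ uniform_limit_disjoint_supports[OF disj'' b'' lim]]) auto
    show "\<bar>?g t\<bar> \<le> 1/8" for t
    proof -
      obtain k where "?g t = f k t" using disjoint_supports_unique[of f t] disj by metis
      then show ?thesis using b[of k t] \<eta>(1)[of k] by auto
    qed
    show "\<bar>?g' t\<bar> \<le> 1/4" for t
    proof -
      obtain k where "?g' t = f' k t" using disjoint_supports_unique[of f' t] disj' by metis
      then show ?thesis using b'[of k t] \<eta>(1)[of k] by auto
    qed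
    show "\<bar>?g'' t\<bar> \<le> 1/2" for t
    proof -
      obtain k where "?g'' t = f'' k t" using disjoint_supports_unique[of f'' t] disj'' by metis
      then show ?thesis using b''[of k t] \<eta>(1)[of k] by auto
    qed
    have zero: "f i (y k) = 0 \<and> f' i (y k) = 0" if "i \<noteq> k" for i k
      using that near[of i "y k"] near_unique[of "y k" i k] h(1)[of k] by auto
    show "?g (y k) = 0" for k
      using suminf_finite[of "{k}" "\<lambda>i. f i (y k)"] zero by (auto simp: f_def bump_at_0)
    show "?g' (y k) = d k" for k
      using suminf_finite[of "{k}" "\<lambda>i. f' i (y k)"] zero by (auto simp: f'_def bump_at_0)
  qed
qed

section \<open>The perturbed sphere and the cone over it\<close>

text \<open>A function that vanishes on \<open>M\<close> is constant along every curve in \<open>M\<close>. The curve is in \<open>M\<close>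
  only for parameters near but different from \<open>0\<close>, so the value at \<open>0\<close> is recovered by continuity.\<close>
lemma tangent_space_annihilated:
  fixes F :: "'a::real_normed_vector \<Rightarrow> real"
  assumes v: "v \<in> tangent_space M p"
    and F: "(F has_derivative F') (at p)" "\<And>x. x \<in> M \<Longrightarrow> F x = 0"
  shows "F' v = 0"
proof -
  obtain c where c: "c 0 = p" "\<forall>\<^sub>F t in at 0. c t \<in> M" "(c has_derivative (\<lambda>h. h *\<^sub>R v)) (at 0)"
    using v by (auto simp: tangent_space_def has_vector_derivative_def)
  have dF: "((\<lambda>t. F (c t)) has_derivative (\<lambda>h. F' (h *\<^sub>R v))) (at 0)"
    using has_derivative_compose[OF c(3), of F F'] F(1) c(1) by simp
  have ev: "\<forall>\<^sub>F t in at 0. F (c t) = 0"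
    using c(2) F(2) by (auto elim: eventually_mono)
  have "((\<lambda>t. F (c t)) \<longlongrightarrow> F (c 0)) (at 0)"
    using has_derivative_continuous[OF dF] by (simp add: isCont_def)
  moreover have "((\<lambda>t. F (c t)) \<longlongrightarrow> 0) (at 0)"
    using ev by (rule tendsto_eventually)
  ultimately have F0: "F (c 0) = 0"
    by (rule tendsto_unique[rotated]) simp
  have "((\<lambda>t. 0) has_derivative (\<lambda>h. F' (h *\<^sub>R v))) (at 0)"
    using has_derivative_transform_eventually[OF dF ev F0 UNIV_I] .
  then have "(\<lambda>h. F' (h *\<^sub>R v)) = (\<lambda>h. 0)"
    by (rule has_derivative_unique) simp
  from fun_cong[OF this, of 1] show ?thesis by simp
qed

text \<open>The bounds keep three things under control: \<open>|g| \<le> 1/8\<close> keeps the body bounded with the centre \<open>axis l 1\<close> inside,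
  \<open>|g'| \<le> 1/4\<close> keeps the gradient pointing outwards, and \<open>|g''| \<le> 1/2\<close> keeps the Hessian positive
  definite.\<close>
locale perturbed_sphere =
  fixes g g' g'' :: "real \<Rightarrow> real" and j l :: "'n::finite"
  assumes jl: "j \<noteq> l"
    and DERIV_g: "\<And>t. (g has_real_derivative g' t) (at t)"
    and DERIV_g': "\<And>t. (g' has_real_derivative g'' t) (at t)"
    and cont_g'': "continuous_on UNIV g''"
    and g_le: "\<And>t. \<bar>g t\<bar> \<le> 1/8"
    and g'_le: "\<And>t. \<bar>g' t\<bar> \<le> 1/4"
    and g''_le: "\<And>t. \<bar>g'' t\<bar> \<le> 1/2"
begin

text \<open>On the hyperplane \<open>x $ l = 1\<close> the part of \<open>Q\<close> without \<open>g\<close> vanishes exactly on the unit sphere around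
  \<open>axis l 1\<close>, because that coordinate contributes \<open>1\<close> to \<open>x \<bullet> x\<close>.\<close>
definition Q :: "real^'n \<Rightarrow> real" where
  "Q x = (x \<bullet> x) / 2 - 1 + g (x $ j)"

definition grad :: "real^'n \<Rightarrow> real^'n" where
  "grad x = x + g' (x $ j) *\<^sub>R axis j 1"

definition \<gamma> :: "(real^'n) set" where
  "\<gamma> = {x. x $ l = 1 \<and> Q x = 0}"

definition cone_surface :: "(real^'n) set" where
  "cone_surface = {t *\<^sub>R p | t p. p \<in> \<gamma> \<and> t > 0}"

lemma has_derivative_Q: "(Q has_derivative (\<lambda>h. grad x \<bullet> h)) (at x)"
proof -
  have nth: "((\<lambda>x. x $ j) has_derivative (\<lambda>h. h $ j)) (at x)"
    by (rule bounded_linear_imp_has_derivative) (rule bounded_linear_vec_nth)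
  have "((\<lambda>x. g (x $ j)) has_derivative (\<lambda>h. g' (x $ j) * h $ j)) (at x)"
    using has_derivative_compose[OF nth DERIV_g[unfolded has_field_derivative_def]] .
  then have "((\<lambda>x. (x \<bullet> x) / 2 - 1 + g (x $ j)) has_derivative
               (\<lambda>h. (x \<bullet> h + h \<bullet> x) / 2 - 0 + g' (x $ j) * h $ j)) (at x)"
    by (auto intro!: derivative_eq_intros)
  then show ?thesis
    unfolding Q_def[abs_def] grad_def
    by (simp add: inner_commute[of x] inner_add_left inner_axis')
qed

text \<open>The second derivative of \<open>Q\<close> at \<open>x\<close> is \<open>L + g'' (x $ j) *\<^sub>R E\<close> for two fixed bilinear forms, the
  inner product \<open>L\<close> and the square \<open>E\<close> of coordinate \<open>j\<close>, so its continuity is that of \<open>g''\<close>.\<close>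
lemma C2_on_Q: "C2_on Q U"
proof -
  define L :: "(real^'n) \<Rightarrow>\<^sub>L (real^'n) \<Rightarrow>\<^sub>L real" where "L = Blinfun blinfun_inner_left"
  have L: "blinfun_apply L = blinfun_inner_left"
    unfolding L_def by (rule bounded_linear_Blinfun_apply) (rule bounded_linear_blinfun_inner_left)
  define E :: "(real^'n) \<Rightarrow>\<^sub>L (real^'n) \<Rightarrow>\<^sub>L real" where
    "E = Blinfun (\<lambda>h. blinfun_inner_left (h $ j *\<^sub>R axis j 1))"
  have E: "blinfun_apply E = (\<lambda>h. blinfun_inner_left (h $ j *\<^sub>R axis j 1))"
    unfolding E_def
    by (intro bounded_linear_Blinfun_apply
          bounded_linear_compose[OF bounded_linear_blinfun_inner_left]
          bounded_linear_compose[OF bounded_linear_scaleR_left] bounded_linear_vec_nth)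
  have nth: "((\<lambda>x. x $ j) has_derivative (\<lambda>h. h $ j)) (at x)" for x :: "real^'n"
    by (rule bounded_linear_imp_has_derivative) (rule bounded_linear_vec_nth)
  have "(grad has_derivative (\<lambda>h. h + (g'' (x $ j) * h $ j) *\<^sub>R axis j 1)) (at x)" for x
    unfolding grad_def[abs_def]
    using has_derivative_compose[OF nth DERIV_g'[unfolded has_field_derivative_def]]
    by (auto intro!: derivative_eq_intros)
  from bounded_linear.has_derivative[OF bounded_linear_blinfun_inner_left this]
  have d2: "((\<lambda>x. blinfun_inner_left (grad x)) has_derivative
          blinfun_apply (L + g'' (x $ j) *\<^sub>R E)) (at x)" for x
    by (rule has_derivative_eq_rhs)
       (auto simp: fun_eq_iff L E blinfun.bilinear_simps intro!: blinfun_eqI simp: inner_add_right)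
  have d1: "(Q has_derivative blinfun_apply (blinfun_inner_left (grad x))) (at x)" for x
    using has_derivative_Q[of x] by (simp add: inner_commute[of "grad x"])
  have cont: "continuous_on U (\<lambda>x. L + g'' (x $ j) *\<^sub>R E)"
    by (intro continuous_intros continuous_on_compose2[OF cont_g'']) auto
  show ?thesis
    unfolding C2_on_def
    by (rule exI[of _ "\<lambda>x. blinfun_inner_left (grad x)"], rule exI[of _ "\<lambda>x. L + g'' (x $ j) *\<^sub>R E"])
       (intro conjI ballI d1 d2 cont)
qed

lemma continuous_on_Q: "continuous_on U Q"
  by (intro continuous_at_imp_continuous_on ballI has_derivative_continuous[OF has_derivative_Q])

text \<open>\<open>Q\<close> is split as \<open>r x - 1 + ((x $ j)\<^sup>2 / 4 + g (x $ j))\<close>. The last summand is convex since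
  \<open>|g''| \<le> 1/2\<close>, and the quadratic form \<open>r\<close> is still positive definite and gives strictness.\<close>
lemma Q_strictly_convex:
  assumes "x \<noteq> y" "0 < u" "u < 1"
  shows "Q ((1 - u) *\<^sub>R x + u *\<^sub>R y) < (1 - u) * Q x + u * Q y"
proof -
  let ?z = "(1 - u) *\<^sub>R x + u *\<^sub>R y"
  have "convex_on UNIV (\<lambda>t. t\<^sup>2 / 4 + g t)"
  proof (rule f''_ge0_imp_convex)
    show "((\<lambda>t. t\<^sup>2 / 4 + g t) has_real_derivative (t / 2 + g' t)) (at t)" for t
      by (auto intro!: derivative_eq_intros DERIV_g)
    show "((\<lambda>t. t / 2 + g' t) has_real_derivative (1 / 2 + g'' t)) (at t)" for t
      by (auto intro!: derivative_eq_intros DERIV_g')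
    show "0 \<le> 1 / 2 + g'' t" for t using g''_le[of t] by linarith
  qed simp
  from convex_onD[OF this, of u "x $ j" "y $ j"]
  have g: "(?z $ j)\<^sup>2 / 4 + g (?z $ j)
      \<le> (1 - u) * ((x $ j)\<^sup>2 / 4 + g (x $ j)) + u * ((y $ j)\<^sup>2 / 4 + g (y $ j))"
    using assms by simp
  define r where "r v = (v \<bullet> v) / 2 - (v $ j)\<^sup>2 / 4" for v :: "real^'n"
  have r: "r ?z = (1 - u) * r x + u * r y - u * (1 - u) * r (x - y)"
    unfolding r_def by (simp add: inner_add inner_diff inner_commute[of y x] field_simps power2_eq_square)
  have "((x - y) $ j)\<^sup>2 \<le> (x - y) \<bullet> (x - y)"
    using component_le_norm_cart[of "x - y" j] power_mono[of "\<bar>(x - y) $ j\<bar>" "norm (x - y)" 2]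
    by (simp add: power2_norm_eq_inner)
  moreover have "(x - y) \<bullet> (x - y) > 0" using assms(1) by simp
  ultimately have "r (x - y) > 0" unfolding r_def by linarith
  then have "u * (1 - u) * r (x - y) > 0" using assms by simp
  then have "r ?z < (1 - u) * r x + u * r y" using r by linarith
  moreover have Q: "Q v = r v - 1 + ((v $ j)\<^sup>2 / 4 + g (v $ j))" for v
    unfolding Q_def r_def by simp
  moreover have "(1 - u) * Q x + u * Q y = ((1 - u) * r x + u * r y) - 1
      + ((1 - u) * ((x $ j)\<^sup>2 / 4 + g (x $ j)) + u * ((y $ j)\<^sup>2 / 4 + g (y $ j)))"
    unfolding Q by (simp only: algebra_simps)
  ultimately show ?thesis using g Q[of ?z] by linarith
qed

lemma Q_neg_between:
  assumes "x \<noteq> y" "0 < u" "u < 1" "Q x \<le> 0" "Q y \<le> 0"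
  shows "Q ((1 - u) *\<^sub>R x + u *\<^sub>R y) < 0"
proof -
  have "(1 - u) * Q x \<le> 0" "u * Q y \<le> 0" using assms by (simp_all add: mult_nonneg_nonpos)
  then show ?thesis using Q_strictly_convex[OF assms(1-3)] by linarith
qed

lemma Q_axis_neg: "Q (axis l 1) < 0"
  using g_le[of "axis l 1 $ j"] by (simp add: Q_def inner_axis_axis)

lemma convex_sublevel: "convex {x. Q x \<le> 0}"
  unfolding convex_alt
proof clarify
  fix x y u assume a: "Q x \<le> 0" "Q y \<le> 0" and u: "0 \<le> u" "u \<le> (1::real)"
  show "Q ((1 - u) *\<^sub>R x + u *\<^sub>R y) \<le> 0"
  proof (cases "x = y \<or> u = 0 \<or> u = 1")
    case True
    then show ?thesis using a by (auto simp flip: scaleR_add_left)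
  next
    case False
    then show ?thesis using Q_neg_between[of x y u] a u by simp
  qed
qed

lemma compact_sublevel: "compact {x. Q x \<le> 0}"
proof -
  have "norm x \<le> 2" if "Q x \<le> 0" for x
  proof -
    have "x \<bullet> x \<le> 2\<^sup>2" using that g_le[of "x $ j"] unfolding Q_def by simp
    then show ?thesis by (simp add: norm_le_square)
  qed
  then have "bounded {x. Q x \<le> 0}" unfolding bounded_iff by blast
  moreover have "closed {x. Q x \<le> 0}"
    by (intro closed_Collect_le continuous_on_Q continuous_on_const)
  ultimately show ?thesis by (simp add: compact_eq_bounded_closed)
qed

lemma open_neg: "open {x. Q x < 0}"
  by (intro open_Collect_less continuous_on_Q continuous_on_const)

lemma interior_sublevel: "interior {x. Q x \<le> 0} = {x. Q x < 0}"
proof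
  show "{x. Q x < 0} \<subseteq> interior {x. Q x \<le> 0}"
    by (rule interior_maximal) (auto simp: open_neg)
  show "interior {x. Q x \<le> 0} \<subseteq> {x. Q x < 0}"
  proof
    fix x assume "x \<in> interior {x. Q x \<le> 0}"
    then obtain e where e: "e > 0" "cball x e \<subseteq> {x. Q x \<le> 0}"
      by (auto simp: mem_interior_cball)
    show "x \<in> {x. Q x < 0}"
    proof (cases "x = axis l 1")
      case True
      then show ?thesis using Q_axis_neg by simp
    next
      case False
      \<comment> \<open>\<open>x\<close> lies strictly between the centre and the point \<open>z\<close> of the body behind it\<close>
      define c where "c = (axis l 1 :: real^'n)"
      define s where "s = e / norm (x - c)"
      define z where "z = x + s *\<^sub>R (x - c)"
      have s: "s > 0" using False e(1) by (simp add: s_def c_def)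
      have "z \<in> cball x e"
        using False e(1) by (simp add: z_def s_def c_def dist_norm)
      then have "Q z \<le> 0" using e by blast
      moreover have "z - c = (1 + s) *\<^sub>R (x - c)" by (simp add: z_def algebra_simps)
      then have "z \<noteq> c" using s False by (auto simp: c_def)
      moreover have "(1 - s / (1 + s)) *\<^sub>R z + (s / (1 + s)) *\<^sub>R c = x"
      proof -
        have "(1 + s) *\<^sub>R ((1 - s / (1 + s)) *\<^sub>R z + (s / (1 + s)) *\<^sub>R c) = z + s *\<^sub>R c"
        proof -
          have "(1 + s) * (1 - s / (1 + s)) = 1" "(1 + s) * (s / (1 + s)) = s"
            using s by (simp_all add: field_simps)
          then show ?thesis by (simp add: scaleR_add_right)
        qed
        also have "\<dots> = (1 + s) *\<^sub>R x" by (simp add: z_def algebra_simps)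
        finally show ?thesis using s by simp
      qed
      ultimately show ?thesis
        using Q_neg_between[of z c "s / (1 + s)"] Q_axis_neg s by (simp add: c_def)
    qed
  qed
qed

lemma affine_coord_hyperplane: "affine (coord_hyperplane l)"
proof -
  have "coord_hyperplane l = {x. axis l 1 \<bullet> x = 1}"
    by (auto simp: coord_hyperplane_def inner_axis')
  then show ?thesis by (simp add: affine_hyperplane)
qed

lemma strictly_convex_closed_\<gamma>: "strictly_convex_closed_in_hyperplane l \<gamma>"
proof -
  define H where "H = (coord_hyperplane l :: (real^'n) set)"
  define D where "D = {x. Q x \<le> 0}"
  have H: "affine H" unfolding H_def by (rule affine_coord_hyperplane)
  have D: "convex D" "compact D" "interior D = {x. Q x < 0}"
    unfolding D_def by (fact convex_sublevel compact_sublevel interior_sublevel)+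
  have "axis l 1 \<in> interior D \<inter> H"
    using Q_axis_neg by (simp add: D H_def coord_hyperplane_def)
  then have ne: "interior D \<inter> H \<noteq> {}" by blast
  have "frontier D = D - {x. Q x < 0}"
    using D(3) compact_imp_closed[OF D(2)] by (simp add: frontier_def)
  also have "\<dots> = {x. Q x = 0}" unfolding D_def by fastforce
  finally have "frontier D = {x. Q x = 0}" .
  then have "\<gamma> = rel_frontier (D \<inter> H)"
    using convex_affine_rel_frontier_Int[OF D(1) H ne] by (auto simp: \<gamma>_def H_def coord_hyperplane_def)
  moreover have "compact (D \<inter> H)"
    using D(2) affine_closed[OF H] by (rule compact_Int_closed)
  moreover have "convex (D \<inter> H)"
    using D(1) affine_imp_convex[OF H] by (rule convex_Int)
  moreover have "affine hull (D \<inter> H) = H"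
    using affine_hull_affine_Int_nonempty_interior[of H D] H ne by (simp add: Int_commute)
  moreover have "open_segment x y \<subseteq> rel_interior (D \<inter> H)"
    if xy: "x \<in> D \<inter> H" "y \<in> D \<inter> H" "x \<noteq> y" for x y
  proof
    fix z assume "z \<in> open_segment x y"
    then obtain u where u: "0 < u" "u < 1" "z = (1 - u) *\<^sub>R x + u *\<^sub>R y"
      by (auto simp: in_segment)
    have "z \<in> H" using xy H u(3) by (auto intro: mem_affine)
    moreover have "Q z < 0" using Q_neg_between[of x y u] xy u by (simp add: D_def)
    ultimately show "z \<in> rel_interior (D \<inter> H)"
      using rel_interior_convex_Int_affine[OF D(1) H ne] D(3) by simp
  qed
  ultimately show ?thesis
    unfolding strictly_convex_closed_in_hyperplane_def H_def by blast
qed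

lemma axis_j_nth_l: "axis j 1 $ l = (0 :: real)"
  using jl by (simp add: axis_def)

text \<open>Since the direction \<open>x - axis l 1\<close> is parallel to the hyperplane, this makes \<open>\<gamma>\<close> a regular level
  set inside the hyperplane and not only in the ambient space.\<close>
lemma grad_outward:
  assumes "x \<in> \<gamma>"
  shows "grad x \<bullet> (x - axis l 1) > 0"
proof -
  have x: "x $ l = 1" "x \<bullet> x = 2 - 2 * g (x $ j)" using assms by (auto simp: \<gamma>_def Q_def)
  have "\<bar>x $ j\<bar>\<^sup>2 \<le> 2\<^sup>2"
    using component_le_norm_cart[of x j] power_mono[of "\<bar>x $ j\<bar>" "norm x" 2] x(2) g_le[of "x $ j"]
    by (simp add: power2_norm_eq_inner)
  then have "\<bar>x $ j\<bar> \<le> 2" by (rule power2_le_imp_le) simp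
  then have "\<bar>g' (x $ j) * x $ j\<bar> \<le> 1/4 * 2"
    unfolding abs_mult using g'_le by (intro mult_mono) auto
  moreover have "grad x \<bullet> (x - axis l 1) = 1 - 2 * g (x $ j) + g' (x $ j) * x $ j"
    using x axis_j_nth_l by (simp add: grad_def inner_add_left inner_diff_right inner_axis inner_axis')
  ultimately show ?thesis using g_le[of "x $ j"] by linarith
qed

lemma hypersurface_\<gamma>: "C2_hypersurface_in_hyperplane l \<gamma>"
  unfolding C2_hypersurface_in_hyperplane_def
proof (intro conjI ballI)
  show "\<gamma> \<subseteq> coord_hyperplane l" by (auto simp: \<gamma>_def coord_hyperplane_def)
  fix p assume p: "p \<in> \<gamma>"
  have "frechet_derivative Q (at p) (p - axis l 1) = grad p \<bullet> (p - axis l 1)"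
    using frechet_derivative_at[OF has_derivative_Q[of p]] by metis
  then have "frechet_derivative Q (at p) (p - axis l 1) \<noteq> 0"
    using grad_outward[OF p] by linarith
  moreover have "p - axis l 1 \<in> coord_direction l"
    using p by (simp add: \<gamma>_def coord_direction_def)
  moreover have "\<gamma> \<inter> UNIV = {x \<in> coord_hyperplane l \<inter> UNIV. Q x = 0}"
    by (auto simp: \<gamma>_def coord_hyperplane_def)
  ultimately show "\<exists>U f. open U \<and> p \<in> U \<and> C2_on f U \<and>
      \<gamma> \<inter> U = {x \<in> coord_hyperplane l \<inter> U. f x = 0} \<and>
      (\<exists>v\<in>coord_direction l. frechet_derivative f (at p) v \<noteq> 0)"
    using C2_on_Q open_UNIV by blast
qed

lemma tangent_\<gamma>:
  assumes "v \<in> tangent_space \<gamma> p"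
  shows "v $ l = 0" "grad p \<bullet> v = 0"
proof -
  have "((\<lambda>x. x $ l - 1) has_derivative (\<lambda>h. h $ l)) (at p)"
    using bounded_linear_imp_has_derivative[OF bounded_linear_vec_nth[of l], of "at p"]
    by (auto intro!: derivative_eq_intros)
  then show "v $ l = 0"
    by (rule tangent_space_annihilated[OF assms]) (simp add: \<gamma>_def)
  show "grad p \<bullet> v = 0"
    by (rule tangent_space_annihilated[OF assms has_derivative_Q]) (simp add: \<gamma>_def)
qed

text \<open>The left factor is a vector and the right factor its image under the Hessian of \<open>Q\<close> at a point with \<open>j\<close>-th
  coordinate \<open>t\<close>.\<close>
lemma hessian_pos:
  fixes v :: "real^'n"
  assumes "v \<noteq> 0"
  shows "v \<bullet> (v + (g'' t * v $ j) *\<^sub>R axis j 1) > 0"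
proof -
  have "(v $ j)\<^sup>2 \<le> v \<bullet> v"
    using component_le_norm_cart[of v j] power_mono[of "\<bar>v $ j\<bar>" "norm v" 2]
    by (simp add: power2_norm_eq_inner)
  moreover have "\<bar>g'' t * (v $ j)\<^sup>2\<bar> \<le> 1/2 * (v $ j)\<^sup>2"
    unfolding abs_mult using g''_le[of t] by (intro mult_mono) auto
  moreover have "v \<bullet> v > 0" using assms by simp
  moreover have "v \<bullet> (v + (g'' t * v $ j) *\<^sub>R axis j 1) = v \<bullet> v + g'' t * (v $ j)\<^sup>2"
    by (simp add: inner_add_right inner_axis power2_eq_square)
  ultimately show ?thesis by linarith
qed

text \<open>The unit normal is the normalised projection \<open>M\<close> of the gradient to the hyperplane directions, so on
  tangent vectors the second fundamental form is the Hessian of \<open>Q\<close> divided by \<open>- |M|\<close>, which is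
  definite.\<close>
lemma second_fundamental_form_\<gamma>:
  assumes p: "p \<in> \<gamma>"
  shows "\<exists>B. has_second_fundamental_form l \<gamma> p B \<and> nondegenerate_form_on (tangent_space \<gamma> p) B"
proof -
  define M where "M x = grad x - x $ l *\<^sub>R axis l 1" for x
  have M_l: "M x $ l = 0" for x
    by (simp add: M_def grad_def axis_j_nth_l)
  have M_inner: "M x \<bullet> v = grad x \<bullet> v" if "v $ l = 0" for x v
    using that by (simp add: M_def inner_diff_left inner_axis')
  have M_nz: "M x \<noteq> 0" if "x \<in> \<gamma>" for x
    using grad_outward[OF that] M_inner[of "x - axis l 1" x] that by (auto simp: \<gamma>_def)
  define N where "N x = inverse (norm (M x)) *\<^sub>R M x" for x
  have normal: "unit_normal_field l \<gamma> N"
    unfolding unit_normal_field_def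
  proof (intro ballI conjI)
    fix x assume x: "x \<in> \<gamma>"
    show "N x \<in> coord_direction l" by (simp add: coord_direction_def N_def M_l)
    show "norm (N x) = 1" using M_nz[OF x] by (simp add: N_def)
    have "v \<bullet> N x = 0" if "v \<in> tangent_space \<gamma> x" for v
      using tangent_\<gamma>[OF that] M_inner[of v x] by (simp add: N_def inner_commute[of v])
    then show "N x \<in> (tangent_space \<gamma> x)\<^sup>\<bottom>"
      by (simp add: orthogonal_comp_def orthogonal_def)
  qed
  define M' where "M' h = h + (g'' (p $ j) * h $ j) *\<^sub>R axis j 1 - h $ l *\<^sub>R axis l 1" for h :: "real^'n"
  have nth: "((\<lambda>x. x $ i) has_derivative (\<lambda>h. h $ i)) (at x)" for x :: "real^'n" and i
    by (rule bounded_linear_imp_has_derivative) (rule bounded_linear_vec_nth)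
  have dM: "(M has_derivative M') (at p)"
    unfolding M_def[abs_def] M'_def[abs_def] grad_def
    using has_derivative_compose[OF nth DERIV_g'[unfolded has_field_derivative_def]]
    by (auto intro!: derivative_eq_intros nth)
  have "(\<lambda>x. norm (M x)) differentiable (at p)"
    using differentiable_compose[of norm M p UNIV] M_nz[OF p] dM differentiableI by auto
  then have "(\<lambda>x. inverse (norm (M x))) differentiable (at p)"
    using M_nz[OF p] by simp
  then obtain \<phi> where \<phi>: "((\<lambda>x. inverse (norm (M x))) has_derivative \<phi>) (at p)"
    unfolding differentiable_def by blast
  define N' where "N' h = inverse (norm (M p)) *\<^sub>R M' h + \<phi> h *\<^sub>R M p" for h
  have "(N has_derivative N') (at p)"
    unfolding N_def[abs_def] N'_def[abs_def] by (rule has_derivative_scaleR[OF \<phi> dM])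
  then have "(N has_derivative N') (at p within \<gamma>)"
    by (rule has_derivative_at_withinI)
  then have "has_second_fundamental_form l \<gamma> p (\<lambda>v w. - (N' v \<bullet> w))"
    unfolding has_second_fundamental_form_def using normal by blast
  moreover have "nondegenerate_form_on (tangent_space \<gamma> p) (\<lambda>v w. - (N' v \<bullet> w))"
    unfolding nondegenerate_form_on_def
  proof (intro ballI impI)
    fix v assume v: "v \<in> tangent_space \<gamma> p" "v \<noteq> 0"
    \<comment> \<open>the derivative of the length of the gradient points in the normal direction, so only the
        Hessian remains\<close>
    have "M' v = v + (g'' (p $ j) * v $ j) *\<^sub>R axis j 1"
      using tangent_\<gamma>(1)[OF v(1)] by (simp add: M'_def)
    then have "M' v \<bullet> v > 0" using hessian_pos[OF v(2)] by (simp add: inner_commute)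
    moreover have "M p \<bullet> v = 0" using tangent_\<gamma>[OF v(1)] M_inner by simp
    ultimately have "N' v \<bullet> v > 0"
      using M_nz[OF p] by (simp add: N'_def inner_add_left)
    then show "\<exists>w\<in>tangent_space \<gamma> p. - (N' v \<bullet> w) \<noteq> 0" using v(1) by force
  qed
  ultimately show ?thesis by blast
qed

lemma smooth_convex_cone: "C2_smooth_convex_cone l cone_surface"
  unfolding C2_smooth_convex_cone_def cone_surface_def
  using hypersurface_\<gamma> strictly_convex_closed_\<gamma> second_fundamental_form_\<gamma> by blast

text \<open>The gradient of \<open>x \<mapsto> Q (x / x $ l)\<close> at \<open>q\<close>, for \<open>q $ l = 1\<close>; the cone is a level set of this
  function.\<close>
definition cone_normal :: "real^'n \<Rightarrow> real^'n" where
  "cone_normal q = grad q - (grad q \<bullet> q) *\<^sub>R axis l 1"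

lemma tangent_cone_normal:
  assumes q: "q \<in> \<gamma>" "r > 0" and v: "v \<in> tangent_space cone_surface (r *\<^sub>R q)"
  shows "cone_normal q \<bullet> v = 0"
proof -
  have ql: "q $ l = 1" using q by (simp add: \<gamma>_def)
  have nth: "((\<lambda>x. x $ l) has_derivative (\<lambda>h. h $ l)) (at (r *\<^sub>R q))"
    by (rule bounded_linear_imp_has_derivative) (rule bounded_linear_vec_nth)
  have "((\<lambda>x. inverse (x $ l)) has_derivative (\<lambda>h. - (inverse r * h $ l * inverse r))) (at (r *\<^sub>R q))"
    using Deriv.has_derivative_inverse[OF _ nth] q ql by simp
  from has_derivative_scaleR[OF this has_derivative_ident]
  have pr: "((\<lambda>x. inverse (x $ l) *\<^sub>R x) has_derivative (\<lambda>h. inverse r *\<^sub>R (h - h $ l *\<^sub>R q))) (at (r *\<^sub>R q))"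
    by (rule has_derivative_eq_rhs) (use q ql in \<open>auto simp: fun_eq_iff algebra_simps\<close>)
  have "inverse ((r *\<^sub>R q) $ l) *\<^sub>R (r *\<^sub>R q) = q" using q ql by simp
  then have "((\<lambda>x. Q (inverse (x $ l) *\<^sub>R x)) has_derivative
         (\<lambda>h. grad q \<bullet> (inverse r *\<^sub>R (h - h $ l *\<^sub>R q)))) (at (r *\<^sub>R q))"
    using has_derivative_compose[OF pr has_derivative_Q] by simp
  then have "grad q \<bullet> (inverse r *\<^sub>R (v - v $ l *\<^sub>R q)) = 0"
    by (rule tangent_space_annihilated[OF v]) (auto simp: cone_surface_def \<gamma>_def)
  then show ?thesis
    using q(2) by (simp add: cone_normal_def inner_diff_left inner_diff_right inner_axis' mult.commute)
qed

text \<open>The body is the convex hull of its extreme points, and these lie on its relative boundary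
  \<open>\<gamma>\<close>.\<close>
lemma neg_in_convex_hull_\<gamma>:
  assumes q: "q $ l = 1" "Q q < 0"
  shows "q \<in> convex hull \<gamma>"
proof -
  define H where "H = (coord_hyperplane l :: (real^'n) set)"
  define D where "D = {x. Q x \<le> 0}"
  have H: "affine H" unfolding H_def by (rule affine_coord_hyperplane)
  have D: "convex D" "compact D" "interior D = {x. Q x < 0}"
    unfolding D_def by (fact convex_sublevel compact_sublevel interior_sublevel)+
  have "q \<in> interior D \<inter> H"
    using q by (simp add: D H_def coord_hyperplane_def)
  then have ne: "interior D \<inter> H \<noteq> {}" by blast
  have "axis l 1 \<in> H" "axis l 1 + axis j 1 \<in> H"
    by (simp_all add: H_def coord_hyperplane_def axis_j_nth_l)
  moreover have "axis l 1 \<noteq> (axis l 1 + axis j 1 :: real^'n)" by (simp add: axis_eq_0_iff)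
  ultimately have "H \<noteq> {x}" for x by (metis singletonD)
  moreover have "affine hull (D \<inter> H) = H"
    using affine_hull_affine_Int_nonempty_interior[of H D] H ne by (simp add: Int_commute)
  ultimately have nontriv: "D \<inter> H \<noteq> {x}" for x
    by (metis affine_hull_sing)
  have "{x. x extreme_point_of (D \<inter> H)} \<subseteq> \<gamma>"
  proof clarify
    fix x assume x: "x extreme_point_of (D \<inter> H)"
    then have "x \<in> D \<inter> H" by (simp add: extreme_point_of_def)
    moreover have "x \<notin> rel_interior (D \<inter> H)"
      using extreme_point_not_in_REL_INTERIOR[OF x nontriv] .
    ultimately show "x \<in> \<gamma>"
      using rel_interior_convex_Int_affine[OF D(1) H ne] D(3)
      by (auto simp: \<gamma>_def D_def H_def coord_hyperplane_def)
  qed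
  then have "convex hull {x. x extreme_point_of (D \<inter> H)} \<subseteq> convex hull \<gamma>"
    by (rule hull_mono)
  moreover have "D \<inter> H = convex hull {x. x extreme_point_of (D \<inter> H)}"
    using Krein_Milman_Minkowski[of "D \<inter> H"] D H
    by (simp add: compact_Int_closed affine_closed convex_Int affine_imp_convex)
  ultimately have "D \<inter> H \<subseteq> convex hull \<gamma>" by simp
  then show ?thesis using q by (auto simp: D_def H_def coord_hyperplane_def)
qed

lemma interior_hull_cone:
  "{x. x $ l > 0 \<and> Q (inverse (x $ l) *\<^sub>R x) < 0} \<subseteq> interior (convex hull cone_surface)"
proof (rule interior_maximal)
  let ?P = "{x :: real^'n. x $ l > 0}"
  have "open ?P" by (intro open_Collect_less continuous_intros)
  moreover have "continuous_on ?P (\<lambda>x. Q (inverse (x $ l) *\<^sub>R x))"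
    by (intro continuous_on_compose2[OF continuous_on_Q[of UNIV]] continuous_intros) auto
  ultimately have "open (?P \<inter> (\<lambda>x. Q (inverse (x $ l) *\<^sub>R x)) -` {..<0})"
    by (intro continuous_open_preimage) auto
  then show "open {x. x $ l > 0 \<and> Q (inverse (x $ l) *\<^sub>R x) < 0}"
    by (simp add: vimage_def Int_def)
  show "{x. x $ l > 0 \<and> Q (inverse (x $ l) *\<^sub>R x) < 0} \<subseteq> convex hull cone_surface"
  proof clarify
    fix x :: "real^'n" assume x: "x $ l > 0" "Q (inverse (x $ l) *\<^sub>R x) < 0"
    have "inverse (x $ l) *\<^sub>R x \<in> convex hull \<gamma>"
      using x by (intro neg_in_convex_hull_\<gamma>) auto
    then have "x $ l *\<^sub>R (inverse (x $ l) *\<^sub>R x) \<in> convex hull ((\<lambda>y. x $ l *\<^sub>R y) ` \<gamma>)"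
      unfolding convex_hull_scaling by (rule imageI)
    moreover have "(\<lambda>y. x $ l *\<^sub>R y) ` \<gamma> \<subseteq> cone_surface"
      using x(1) by (auto simp: cone_surface_def)
    ultimately show "x \<in> convex hull cone_surface"
      using x(1) hull_mono by fastforce
  qed
qed

lemma chord_in_interior_hull:
  assumes q: "q1 \<in> \<gamma>" "q2 \<in> \<gamma>" "q1 \<noteq> q2" and r: "r1 > 0" "r2 > 0"
  shows "open_segment (r1 *\<^sub>R q1) (r2 *\<^sub>R q2) \<subseteq> interior (convex hull cone_surface)"
proof
  fix z assume "z \<in> open_segment (r1 *\<^sub>R q1) (r2 *\<^sub>R q2)"
  then obtain t where t: "0 < t" "t < 1" "z = (1 - t) *\<^sub>R (r1 *\<^sub>R q1) + t *\<^sub>R (r2 *\<^sub>R q2)"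
    by (auto simp: in_segment)
  have zl: "z $ l = (1 - t) * r1 + t * r2" using q t(3) by (simp add: \<gamma>_def)
  have pos: "(1 - t) * r1 > 0" "t * r2 > 0" using t r by simp_all
  define s where "s = t * r2 / (z $ l)"
  have s: "0 < s" "s < 1" using pos zl by (simp_all add: s_def)
  have "1 - s = (1 - t) * r1 / (z $ l)" using pos zl by (simp add: s_def field_simps)
  then have "inverse (z $ l) *\<^sub>R z = (1 - s) *\<^sub>R q1 + s *\<^sub>R q2"
    unfolding s_def t(3) scaleR_add_right by (simp add: divide_inverse_commute)
  then have "Q (inverse (z $ l) *\<^sub>R z) < 0"
    using Q_neg_between[OF q(3) s] q by (simp add: \<gamma>_def)
  then show "z \<in> interior (convex hull cone_surface)"
    using interior_hull_cone zl pos by auto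
qed

text \<open>The reflection law needs vectors that really are velocities of curves in the cone. Within the
  span of the axes \<open>i\<close>, \<open>j\<close>, \<open>l\<close> and where the \<open>i\<close>-th coordinate is positive, the equation of \<open>\<gamma>\<close>
  can be solved explicitly as \<open>X = sqrt (1 - Y\<^sup>2 - 2 * g Y)\<close>, so such a curve can be written down: move
  \<open>Y\<close> and the scaling factor linearly.\<close>
lemma tangent_coneI:
  fixes i :: 'n
  assumes ij: "i \<noteq> j" "i \<noteq> l"
    and q_def: "q = x *\<^sub>R axis i 1 + y *\<^sub>R axis j 1 + axis l 1"
    and u_def: "u = a *\<^sub>R axis i 1 + b *\<^sub>R axis j 1 + c *\<^sub>R axis l 1"
    and q: "q \<in> \<gamma>" and x: "x > 0" and r: "r > 0" and n: "cone_normal q \<bullet> u = 0"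
  shows "u \<in> tangent_space cone_surface (r *\<^sub>R q)"
proof -
  have ax: "axis i 1 $ i = (1::real)" "axis j 1 $ j = (1::real)" "axis l 1 $ l = (1::real)"
    "axis i 1 $ j = (0::real)" "axis i 1 $ l = (0::real)" "axis j 1 $ i = (0::real)"
    "axis j 1 $ l = (0::real)" "axis l 1 $ i = (0::real)" "axis l 1 $ j = (0::real)"
    using ij jl by (auto simp: axis_def)
  note ip = inner_add_left inner_add_right inner_diff_left inner_axis inner_axis' ax
  have Qv: "Q (X *\<^sub>R axis i 1 + Y *\<^sub>R axis j 1 + axis l 1) = (X\<^sup>2 + Y\<^sup>2 - 1) / 2 + g Y" for X Y
    by (simp add: Q_def ip power2_eq_square field_simps)
  have "(x\<^sup>2 + y\<^sup>2 - 1) / 2 + g y = 0" using q Qv[of x y] by (simp add: \<gamma>_def q_def)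
  then have x2: "1 - y\<^sup>2 - 2 * g y = x\<^sup>2" by (simp add: field_simps)
  have a: "x * a = c * (x\<^sup>2 + y * (y + g' y)) - (y + g' y) * b"
    using n unfolding q_def u_def by (simp add: cone_normal_def grad_def ip power2_eq_square algebra_simps)
  define s where "s = (b - c * y) / r"
  define Y where "Y t = y + t * s" for t
  define X where "X t = sqrt (1 - (Y t)\<^sup>2 - 2 * g (Y t))" for t
  define w where "w t = (r + c * t) *\<^sub>R (X t *\<^sub>R axis i 1 + Y t *\<^sub>R axis j 1 + axis l 1 :: real^'n)" for t
  have X0: "X 0 = x" "Y 0 = y" using x by (simp_all add: X_def Y_def x2)
  have dY: "(Y has_real_derivative s) (at t)" for t
    unfolding Y_def[abs_def] by (auto intro!: derivative_eq_intros)
  have "((\<lambda>t. 1 - (Y t)\<^sup>2 - 2 * g (Y t)) has_real_derivative (- 2 * (y + g' y) * s)) (at 0)"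
    using DERIV_chain2[OF DERIV_g dY, of 0]
    by (auto intro!: derivative_eq_intros dY simp: X0 algebra_simps)
  note dR = this
  have dX: "(X has_real_derivative (- ((y + g' y) * s / x))) (at 0)"
    unfolding X_def[abs_def]
    by (rule DERIV_cong[OF DERIV_chain2[OF DERIV_real_sqrt dR]])
       (unfold X0 x2, use x in \<open>simp_all add: field_simps\<close>)
  have dr: "((\<lambda>t. r + c * t) has_real_derivative c) (at 0)"
    by (auto intro!: derivative_eq_intros)
  have dv: "((\<lambda>t. X t *\<^sub>R axis i 1 + Y t *\<^sub>R axis j 1 + axis l 1 :: real^'n) has_vector_derivative
              (- ((y + g' y) * s / x)) *\<^sub>R axis i 1 + s *\<^sub>R axis j 1) (at 0)"
    by (auto intro!: derivative_eq_intros dX dY)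
  have "(w has_vector_derivative
           (r *\<^sub>R ((- ((y + g' y) * s / x)) *\<^sub>R axis i 1 + s *\<^sub>R axis j 1) + c *\<^sub>R q)) (at 0)"
    using has_vector_derivative_scaleR[OF dr dv] unfolding w_def[abs_def] by (simp add: X0 q_def)
  also have "r *\<^sub>R ((- ((y + g' y) * s / x)) *\<^sub>R axis i 1 + s *\<^sub>R axis j 1) + c *\<^sub>R q = u"
  proof -
    have rs: "r * s = b - c * y" using r by (simp add: s_def)
    have "c * x - (y + g' y) * (b - c * y) / x = a"
      using a x by (simp add: field_simps power2_eq_square)
    then have "- (r * ((y + g' y) * s / x)) + c * x = a"
      by (simp flip: rs add: algebra_simps)
    moreover have "r * s + c * y = b" using rs by simp
    moreover have "r *\<^sub>R ((- ((y + g' y) * s / x)) *\<^sub>R axis i 1 + s *\<^sub>R axis j 1) + c *\<^sub>R q =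
      (- (r * ((y + g' y) * s / x)) + c * x) *\<^sub>R axis i 1 + (r * s + c * y) *\<^sub>R axis j 1 + c *\<^sub>R axis l (1::real)"
      by (simp add: q_def algebra_simps)
    ultimately show ?thesis by (simp add: u_def)
  qed
  finally have dw: "(w has_vector_derivative u) (at 0)" .
  have "\<forall>\<^sub>F t in at 0. r + c * t > 0"
    using dr[THEN DERIV_isCont] r by (intro order_tendstoD) (auto simp: isCont_def)
  moreover have "((\<lambda>t. 1 - (Y t)\<^sup>2 - 2 * g (Y t)) \<longlongrightarrow> x\<^sup>2) (at 0)"
    using dR[THEN DERIV_isCont] unfolding isCont_def X0 x2 .
  then have "\<forall>\<^sub>F t in at 0. 1 - (Y t)\<^sup>2 - 2 * g (Y t) > 0"
    by (rule order_tendstoD) (use x in simp)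
  ultimately have "\<forall>\<^sub>F t in at 0. w t \<in> cone_surface"
  proof eventually_elim
    case (elim t)
    have "(X t)\<^sup>2 = 1 - (Y t)\<^sup>2 - 2 * g (Y t)" using elim by (simp add: X_def)
    then have "X t *\<^sub>R axis i 1 + Y t *\<^sub>R axis j 1 + axis l 1 \<in> \<gamma>"
      by (simp add: \<gamma>_def Qv ax)
    then show ?case using elim(1) unfolding cone_surface_def w_def by blast
  qed
  moreover have "w 0 = r *\<^sub>R q" by (simp add: w_def X0 q_def)
  ultimately show ?thesis unfolding tangent_space_def using dw by blast
qed

end

section \<open>The angles of the trajectory\<close>

text \<open>The tangent of half of the angle, seen from the apex, under which edge \<open>k\<close> of the trajectory
  appears. All other data of the trajectory derive from this sequence. It telescopes, and the
  shift by \<open>3000\<close> makes it so slowly varying that the slopes needed below are small from the start.\<close>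
definition half_tan :: "nat \<Rightarrow> real" where
  "half_tan k = 1 / ((real k + 3000) * (real k + 3001))"

text \<open>For an edge between two points of the cone over the unit circle \<open>(cos \<phi>, sin \<phi>, 1)\<close>, the edge angle is
  the angle at the apex and the base angle is the difference of the values of \<open>\<phi>\<close>. With
  \<open>t = tan (edge_angle t / 2)\<close>, a right spherical triangle gives the second
  formula; its content is \<open>2 * cos (edge_angle t) = 1 + cos (base_angle t)\<close>, the inner product of
  two such points.\<close>
definition edge_angle :: "real \<Rightarrow> real" where
  "edge_angle t = 2 * arctan t"

definition base_angle :: "real \<Rightarrow> real" where
  "base_angle t = 2 * arctan (sqrt 2 * t / sqrt (1 - t\<^sup>2))"

lemma one_plus_square_pos: "0 < 1 + (t::real)\<^sup>2"
  using zero_le_power2[of t] by linarith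

lemma cos_double_arctan: "cos (2 * arctan t) = (1 - t\<^sup>2) / (1 + t\<^sup>2)"
proof -
  show ?thesis
    using one_plus_square_pos[of t]
    by (simp add: cos_double cos_arctan sin_arctan power_divide diff_divide_distrib)
qed

lemma sin_double_arctan: "sin (2 * arctan t) = 2 * t / (1 + t\<^sup>2)"
proof -
  show ?thesis
    using one_plus_square_pos[of t] by (simp add: sin_double cos_arctan sin_arctan)
qed

lemma cos_base_angle:
  assumes "0 < t" "t < 1"
  shows "cos (base_angle t) = 2 * cos (edge_angle t) - 1"
proof -
  have t: "0 < 1 - t\<^sup>2" "0 < 1 + t\<^sup>2"
    using assms one_plus_square_pos[of t] by (auto simp: abs_square_less_1)
  then have "(sqrt 2 * t / sqrt (1 - t\<^sup>2))\<^sup>2 = 2 * t\<^sup>2 / (1 - t\<^sup>2)"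
    and "1 - 2 * t\<^sup>2 / (1 - t\<^sup>2) = (1 - 3 * t\<^sup>2) / (1 - t\<^sup>2)"
    and "1 + 2 * t\<^sup>2 / (1 - t\<^sup>2) = (1 + t\<^sup>2) / (1 - t\<^sup>2)"
    using t by (simp_all add: power_divide power_mult_distrib field_simps)
  then have "cos (base_angle t) = (1 - 3 * t\<^sup>2) / (1 + t\<^sup>2)"
    unfolding base_angle_def cos_double_arctan using t by simp
  then show ?thesis
    unfolding edge_angle_def cos_double_arctan using t by (simp add: field_simps)
qed

lemma sin_base_angle:
  assumes "0 < t" "t < 1"
  shows "sin (base_angle t) = sqrt 2 * sqrt (1 - t\<^sup>2) * sin (edge_angle t)"
proof -
  have t: "0 < 1 - t\<^sup>2" "0 < 1 + t\<^sup>2"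
    using assms one_plus_square_pos[of t] by (auto simp: abs_square_less_1)
  define s where "s = sqrt (1 - t\<^sup>2)"
  have s: "s > 0" "s\<^sup>2 = 1 - t\<^sup>2" using t by (simp_all add: s_def)
  have "1 + (sqrt 2 * t / s)\<^sup>2 = (1 + t\<^sup>2) / s\<^sup>2"
    using s by (simp add: power_divide power_mult_distrib field_simps)
  then show ?thesis
    unfolding base_angle_def edge_angle_def sin_double_arctan s_def[symmetric] using s(1) t
    by (simp add: field_simps power2_eq_square)
qed

definition edge_pos :: "nat \<Rightarrow> real" where
  "edge_pos k = (\<Sum>i<k. edge_angle (half_tan i))"

definition base_pos :: "nat \<Rightarrow> real" where
  "base_pos k = (\<Sum>i<k. base_angle (half_tan i))"

lemma half_tan_pos: "half_tan k > 0" by (simp add: half_tan_def)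

lemma half_tan_le: "half_tan k \<le> 1/1000"
proof -
  have "1000 * 1 \<le> (real k + 3000) * (real k + 3001)" by (intro mult_mono) auto
  then show ?thesis unfolding half_tan_def by (intro frac_le) auto
qed

lemma half_tan_antimono: "half_tan (Suc k) \<le> half_tan k"
  unfolding half_tan_def by (intro divide_left_mono mult_mono) auto

lemma half_tan_sq: "(half_tan k)\<^sup>2 \<le> half_tan k / 1000"
  using mult_left_mono[OF half_tan_le[of k], of "half_tan k"] half_tan_pos[of k] by (simp add: power2_eq_square)

lemma sum_half_tan_le: "(\<Sum>i<k. half_tan i) \<le> 1/3000"
proof -
  have "1 / (a * (a + 1)) = 1 / a - 1 / (a + 1)" if "a > 0" for a :: real
    using that by (simp add: field_simps)
  from this[of "real k + 3000" for k] have "half_tan k = 1 / (real k + 3000) - 1 / (real (Suc k) + 3000)" for k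
    by (simp add: half_tan_def add_ac)
  then have "(\<Sum>i<k. half_tan i) = 1/3000 - 1 / (real k + 3000)"
    by (induction k) simp_all
  then show ?thesis by simp
qed

lemma summable_half_tan: "summable half_tan"
  by (rule bounded_imp_summable[of _ "1/3000"])
     (use half_tan_pos sum_half_tan_le[of "Suc _", unfolded lessThan_Suc_atMost] in \<open>auto intro: less_imp_le\<close>)

lemma half_tan_diff: "half_tan (Suc k) - half_tan k = - 2 * half_tan (Suc k) / (real (Suc k) + 2999)"
proof -
  have "1 / ((a + 1) * (a + 2)) - 1 / (a * (a + 1)) = - 2 * (1 / ((a + 1) * (a + 2))) / a"
    if "a > 0" for a :: real
    using that by (simp add: divide_simps)
  from this[of "real k + 3000"] show ?thesis by (simp add: half_tan_def add_ac)
qed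

lemma root_half_tan: "sqrt (1 - (half_tan k)\<^sup>2) \<ge> 9/10"
  using half_tan_sq[of k] half_tan_le[of k] by (intro real_le_rsqrt) (simp add: power2_eq_square)

lemma edge_angle_bounds: "0 \<le> edge_angle (half_tan k)" "edge_angle (half_tan k) \<le> 2 * half_tan k"
  using half_tan_pos[of k] arctan_le_self[of "half_tan k"] by (simp_all add: edge_angle_def)

lemma base_angle_bounds: "0 \<le> base_angle (half_tan k)" "base_angle (half_tan k) \<le> 4 * half_tan k"
proof -
  let ?s = "sqrt (1 - (half_tan k)\<^sup>2)"
  have s: "?s \<ge> 9/10" by (rule root_half_tan)
  then have nn: "0 \<le> sqrt 2 * half_tan k / ?s" using half_tan_pos[of k] s by (intro divide_nonneg_nonneg mult_nonneg_nonneg) (linarith | simp)+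
  then show "0 \<le> base_angle (half_tan k)" by (simp add: base_angle_def)
  have "sqrt 2 \<le> 3/2" by (intro real_le_lsqrt) (auto simp: power2_eq_square)
  then have "sqrt 2 * half_tan k \<le> (2 * ?s) * half_tan k" using s half_tan_pos[of k] by (intro mult_right_mono) auto
  then have "sqrt 2 * half_tan k / ?s \<le> 2 * half_tan k" using s by (subst pos_divide_le_eq) (linarith, simp add: mult_ac)
  then show "base_angle (half_tan k) \<le> 4 * half_tan k"
    using arctan_le_self[OF nn] by (simp add: base_angle_def)
qed

lemma edge_pos_bounds: "0 \<le> edge_pos k" "edge_pos k \<le> 1/100"
proof -
  show "0 \<le> edge_pos k" unfolding edge_pos_def by (intro sum_nonneg edge_angle_bounds)
  have "edge_pos k \<le> (\<Sum>i<k. 2 * half_tan i)" unfolding edge_pos_def by (intro sum_mono edge_angle_bounds)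
  then show "edge_pos k \<le> 1/100" using sum_half_tan_le[of k] by (simp flip: sum_distrib_left)
qed

lemma base_pos_bounds: "0 \<le> base_pos k" "base_pos k \<le> 1/100"
proof -
  show "0 \<le> base_pos k" unfolding base_pos_def by (intro sum_nonneg base_angle_bounds)
  have "base_pos k \<le> (\<Sum>i<k. 4 * half_tan i)" unfolding base_pos_def by (intro sum_mono base_angle_bounds)
  then show "base_pos k \<le> 1/100" using sum_half_tan_le[of k] by (simp flip: sum_distrib_left)
qed

lemma cos_ge_near_0:
  fixes x :: real
  assumes "0 \<le> x" "x \<le> 1/100"
  shows "cos x \<ge> 9/10"
proof -
  have "x\<^sup>2 \<le> (1/100)\<^sup>2" using assms by (intro power_mono) auto
  moreover have "\<bar>sin x\<bar> \<le> \<bar>x\<bar>" by (rule abs_sin_x_le_abs_x)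
  then have "(sin x)\<^sup>2 \<le> x\<^sup>2" by (simp add: abs_le_square_iff)
  ultimately have "(9/10)\<^sup>2 \<le> (cos x)\<^sup>2"
    unfolding cos_squared_eq by (simp add: power_divide)
  moreover have "cos x \<ge> 0" using assms pi_gt3 by (intro cos_ge_zero) auto
  ultimately show ?thesis by (rule power2_le_imp_le)
qed

lemma cos_edge_pos: "cos (edge_pos k) \<ge> 9/10"
  by (intro cos_ge_near_0 edge_pos_bounds)

lemma cos_base_pos: "cos (base_pos k) \<ge> 9/10"
  by (intro cos_ge_near_0 base_pos_bounds)

text \<open>The gaps between the heights of the vertices are at least \<open>half_tan k\<close>, so there is room for a bump of half-width
  \<open>half_tan k / 2\<close> around each of them.\<close>
lemma base_gap: "sin (base_pos (Suc k)) - sin (base_pos k) \<ge> half_tan k"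
proof -
  let ?t = "half_tan k" and ?\<phi> = "base_pos k" and ?b = "base_angle (half_tan k)"
  have t: "0 < ?t" "?t < 1" "?t\<^sup>2 \<le> ?t / 1000" "?t \<le> 1/1000"
    using half_tan_pos[of k] half_tan_le[of k] half_tan_sq[of k] by auto
  note d = one_plus_square_pos[of ?t]
  have "1 - cos ?b = 4 * ?t\<^sup>2 / (1 + ?t\<^sup>2)"
    unfolding cos_base_angle[OF t(1,2)] edge_angle_def cos_double_arctan using d
    by (simp add: field_simps)
  also have "\<dots> \<le> 4 * ?t\<^sup>2 / 1" by (intro frac_le) auto
  finally have "1 - cos ?b \<le> ?t / 100" using t by linarith
  moreover have "sin ?\<phi> * (1 - cos ?b) \<le> 1 * (1 - cos ?b)"
    by (intro mult_right_mono) auto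
  ultimately have small: "sin ?\<phi> * (1 - cos ?b) \<le> ?t / 100" unfolding mult_1 by (rule order_trans[rotated])
  have "sin ?b \<ge> 2 * ?t"
  proof -
    have "1 + ?t\<^sup>2 \<le> sqrt 2 * sqrt (1 - ?t\<^sup>2)"
    proof -
      have "(1 + ?t\<^sup>2)\<^sup>2 \<le> 2 * (1 - ?t\<^sup>2)"
      proof -
        have "?t\<^sup>2 \<le> 1/1000" using t by linarith
        moreover from this have "?t\<^sup>2 * ?t\<^sup>2 \<le> 1 * ?t\<^sup>2" by (intro mult_right_mono) auto
        ultimately show ?thesis by (simp add: power2_eq_square algebra_simps)
      qed
      then show ?thesis by (simp flip: real_sqrt_mult add: real_le_rsqrt)
    qed
    then have "(1 + ?t\<^sup>2) * (2 * ?t / (1 + ?t\<^sup>2)) \<le> sqrt 2 * sqrt (1 - ?t\<^sup>2) * (2 * ?t / (1 + ?t\<^sup>2))"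
      using t d by (intro mult_right_mono) auto
    then show ?thesis
      unfolding sin_base_angle[OF t(1,2)] edge_angle_def sin_double_arctan using d by simp
  qed
  then have large: "9/10 * (2 * ?t) \<le> cos ?\<phi> * sin ?b"
    using cos_base_pos[of k] t by (intro mult_mono) auto
  have "sin (base_pos (Suc k)) - sin ?\<phi> = cos ?\<phi> * sin ?b - sin ?\<phi> * (1 - cos ?b)"
    by (simp add: base_pos_def sin_add algebra_simps)
  also have "\<dots> \<ge> 9/10 * (2 * ?t) - ?t / 100" using large small by (rule diff_mono)
  also have "9/10 * (2 * ?t) - ?t / 100 \<ge> ?t" using t by simp
  finally show ?thesis .
qed

text \<open>The reflection law at vertex \<open>k\<close> forces the normal of the curve to be the radial direction plus \<open>tilt k\<close>
  times the tangential direction of the circle. At \<open>k = 0\<close>, where the trajectory starts and no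
  law is imposed, \<open>k - 1 = 0\<close> makes the tilt vanish.\<close>
definition tilt :: "nat \<Rightarrow> real" where
  "tilt k = sqrt 2 * (half_tan k - half_tan (k - 1)) / (sqrt (1 - (half_tan k)\<^sup>2) + sqrt (1 - (half_tan (k - 1))\<^sup>2))"

text \<open>The vector \<open>(cos \<phi>, sin \<phi> + d)\<close> is parallel to \<open>(cos \<phi>, sin \<phi>) + \<tau> (- sin \<phi>, cos \<phi>)\<close> exactly for
  \<open>d = \<tau> / (cos \<phi> - \<tau> * sin \<phi>)\<close>; so this is the derivative which the perturbation must have at the
  height \<open>sin \<phi>\<close> of the vertex.\<close>
definition slope :: "nat \<Rightarrow> real" where
  "slope k = tilt k / (cos (base_pos k) - tilt k * sin (base_pos k))"

text \<open>The relative change of \<open>half_tan\<close> from one index to the next is of order \<open>1/k\<close>, so the tilt is smaller than the gaps by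
  this factor.\<close>
lemma abs_tilt_le: "\<bar>tilt k\<bar> \<le> 3 * half_tan k / (real k + 2999)"
proof (cases k)
  case 0
  then show ?thesis using half_tan_pos[of 0] by (simp add: tilt_def)
next
  case (Suc m)
  let ?S = "sqrt (1 - (half_tan k)\<^sup>2) + sqrt (1 - (half_tan m)\<^sup>2)"
  have S: "?S \<ge> 1" using root_half_tan[of k] root_half_tan[of m] by linarith
  have "sqrt 2 \<le> 3/2" by (intro real_le_lsqrt) (auto simp: power2_eq_square)
  have "\<bar>tilt k\<bar> = sqrt 2 * (2 * half_tan k / (real k + 2999)) / ?S"
    using S half_tan_pos[of k] half_tan_diff[of m] unfolding tilt_def Suc
    by (simp add: abs_mult abs_divide)
  also have "\<dots> \<le> 3/2 * (2 * half_tan k / (real k + 2999)) / 1"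
    using S half_tan_pos[of k] \<open>sqrt 2 \<le> 3/2\<close> by (intro frac_le mult_right_mono) auto
  finally show ?thesis by simp
qed

lemma tilt_denominator: "cos (base_pos k) - tilt k * sin (base_pos k) \<ge> 1/2"
proof -
  have "3 * half_tan k / (real k + 2999) \<le> 3 * (1/1000) / 1"
    using half_tan_le[of k] half_tan_pos[of k] by (intro frac_le mult_left_mono) auto
  then have "\<bar>tilt k\<bar> \<le> 3/1000" using abs_tilt_le[of k] by linarith
  then have "\<bar>tilt k * sin (base_pos k)\<bar> \<le> 3/1000 * 1"
    unfolding abs_mult by (intro mult_mono) auto
  then show ?thesis using cos_base_pos[of k] by linarith
qed

lemma abs_slope_le: "\<bar>slope k\<bar> \<le> 12 / (real k + 2999) * (half_tan k / 2)"
proof -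
  have "\<bar>slope k\<bar> \<le> (3 * half_tan k / (real k + 2999)) / (1/2)"
    unfolding slope_def abs_divide using abs_tilt_le[of k] tilt_denominator[of k] half_tan_pos[of k]
    by (intro frac_le) auto
  also have "(3 * t / a) / (1/2) = 12 / a * (t / 2)" for t a :: real
    by simp
  finally show ?thesis .
qed

lemma perturbation_exists:
  obtains g g' g'' :: "real \<Rightarrow> real" where
    "\<And>t. (g has_real_derivative g' t) (at t)"
    "\<And>t. (g' has_real_derivative g'' t) (at t)"
    "continuous_on UNIV g''"
    "\<And>t. \<bar>g t\<bar> \<le> 1/8" "\<And>t. \<bar>g' t\<bar> \<le> 1/4" "\<And>t. \<bar>g'' t\<bar> \<le> 1/2"
    "\<And>k. g (sin (base_pos k)) = 0" "\<And>k. g' (sin (base_pos k)) = slope k"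
proof (rule C2_interpolation_of_small_slopes)
  show "sin (base_pos k) + half_tan k / 2 \<le> sin (base_pos (Suc k)) - half_tan (Suc k) / 2" for k
    using base_gap[of k] half_tan_antimono[of k] by (simp add: field_simps)
  show "half_tan k / 2 > 0" "half_tan k / 2 \<le> 1" for k using half_tan_pos[of k] half_tan_le[of k] by auto
  show "\<bar>slope k\<bar> \<le> 12 / (real k + 2999) * (half_tan k / 2)" for k by (rule abs_slope_le)
  show "12 / (real k + 2999) \<le> 1/100" for k by (simp add: field_simps)
  show "(\<lambda>k. 12 / (real k + 2999)) \<longlonglongrightarrow> 0" by real_asymp
qed (rule that; assumption)

section \<open>The trajectory\<close>

locale billiard_table = perturbed_sphere g g' g'' j l
  for g g' g'' :: "real \<Rightarrow> real" and j l :: "'n::finite" +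
  fixes i :: 'n
  assumes ij: "i \<noteq> j" and il: "i \<noteq> l"
    and g_node: "\<And>k. g (sin (base_pos k)) = 0"
    and g'_node: "\<And>k. g' (sin (base_pos k)) = slope k"
begin

lemma axis_nth:
  "axis i 1 $ i = (1::real)" "axis j 1 $ j = (1::real)" "axis l 1 $ l = (1::real)"
  "axis i 1 $ j = (0::real)" "axis i 1 $ l = (0::real)" "axis j 1 $ i = (0::real)"
  "axis j 1 $ l = (0::real)" "axis l 1 $ i = (0::real)" "axis l 1 $ j = (0::real)"
  using ij il jl by (auto simp: axis_def)

lemmas inner_axes = inner_add_left inner_add_right inner_diff_left inner_diff_right
  inner_axis inner_axis' axis_nth

text \<open>The circle that carries the vertices, with the frame at the point of angle \<open>\<phi>\<close>: \<open>circ_normal\<close> is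
  normal to the round cone over the circle, and \<open>circ_tangent\<close> is the velocity along the circle.\<close>
definition circ :: "real \<Rightarrow> real^'n" where
  "circ \<phi> = cos \<phi> *\<^sub>R axis i 1 + sin \<phi> *\<^sub>R axis j 1 + axis l 1"

definition circ_normal :: "real \<Rightarrow> real^'n" where
  "circ_normal \<phi> = cos \<phi> *\<^sub>R axis i 1 + sin \<phi> *\<^sub>R axis j 1 - axis l 1"

definition circ_tangent :: "real \<Rightarrow> real^'n" where
  "circ_tangent \<phi> = (- sin \<phi>) *\<^sub>R axis i 1 + cos \<phi> *\<^sub>R axis j 1"

lemma circ_inner: "circ \<phi> \<bullet> circ \<psi> = 1 + cos (\<phi> - \<psi>)"
  by (simp add: circ_def inner_axes cos_diff)

definition node :: "nat \<Rightarrow> real^'n" where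
  "node k = circ (base_pos k)"

text \<open>The scaling makes the angle between an edge and the ray through its end point the same on both
  sides of the vertex, whatever the edges are: if the trajectory is unfolded into the plane, the
  points with polar angle \<open>edge_pos k\<close> and radius proportional to \<open>1 / cos (edge_pos k)\<close> lie on one
  straight line.\<close>
definition traj :: "nat \<Rightarrow> real^'n" where
  "traj k = inverse (cos (edge_pos k)) *\<^sub>R node k"

lemma node_in_\<gamma>: "node k \<in> \<gamma>"
proof -
  have "node k \<bullet> node k = 2" by (simp add: node_def circ_inner)
  moreover have "node k $ j = sin (base_pos k)" "node k $ l = 1"
    by (simp_all add: node_def circ_def axis_nth)
  ultimately show ?thesis using g_node[of k] by (simp add: \<gamma>_def Q_def)
qed

lemma half_tan_less_1: "half_tan k < 1" using half_tan_le[of k] by linarith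

lemma node_inner_Suc: "node k \<bullet> node (Suc k) = 2 * cos (edge_angle (half_tan k))"
  using cos_base_angle[OF half_tan_pos half_tan_less_1, of k]
  by (simp add: node_def circ_inner base_pos_def)

lemma sin_edge_angle_pos: "sin (edge_angle (half_tan k)) > 0"
  using half_tan_pos[of k] one_plus_square_pos[of "half_tan k"] by (simp add: edge_angle_def sin_double_arctan)

lemma edge_pos_Suc: "edge_pos (Suc k) = edge_pos k + edge_angle (half_tan k)"
  and base_pos_Suc: "base_pos (Suc k) = base_pos k + base_angle (half_tan k)"
  by (simp_all add: edge_pos_def base_pos_def)

lemma traj_Suc_diff:
  "traj (Suc k) - traj k = inverse (cos (edge_pos k) * cos (edge_pos (Suc k))) *\<^sub>R
     (cos (edge_pos k) *\<^sub>R node (Suc k) - cos (edge_pos (Suc k)) *\<^sub>R node k)"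
proof -
  let ?a = "cos (edge_pos k)" and ?b = "cos (edge_pos (Suc k))"
  have "inverse (?a * ?b) * ?a = inverse ?b" "inverse (?a * ?b) * ?b = inverse ?a"
    using cos_edge_pos[of k] cos_edge_pos[of "Suc k"] by (auto simp: field_simps)
  then show ?thesis
    by (simp only: traj_def scaleR_diff_right scaleR_scaleR)
qed

text \<open>Pythagoras in disguise: the identity
  \<open>cos\<^sup>2 \<alpha> + cos\<^sup>2 \<beta> - 2 cos \<alpha> cos \<beta> cos (\<beta> - \<alpha>) = sin\<^sup>2 (\<beta> - \<alpha>)\<close> for two consecutive edge
  positions.\<close>
lemma norm_chord:
  "norm (cos (edge_pos k) *\<^sub>R node (Suc k) - cos (edge_pos (Suc k)) *\<^sub>R node k)
    = sqrt 2 * sin (edge_angle (half_tan k))" (is "norm ?A = _")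
proof -
  let ?C = "cos (edge_pos k)" and ?S = "sin (edge_pos k)"
    and ?c = "cos (edge_angle (half_tan k))" and ?s = "sin (edge_angle (half_tan k))"
  have C': "cos (edge_pos (Suc k)) = ?C * ?c - ?S * ?s"
    by (simp add: edge_pos_Suc cos_add)
  have nn: "node m \<bullet> node m = 2" for m by (simp add: node_def circ_inner)
  have pyth: "?S\<^sup>2 = 1 - ?C\<^sup>2" "?s\<^sup>2 = 1 - ?c\<^sup>2" by (simp_all add: sin_squared_eq)
  have "?A \<bullet> ?A = 2 * (?C\<^sup>2 + (?C * ?c - ?S * ?s)\<^sup>2 - 2 * ?C * (?C * ?c - ?S * ?s) * ?c)"
    unfolding C' by (simp add: inner_diff_left inner_diff_right nn node_inner_Suc
      inner_commute[of "node (Suc k)" "node k"] power2_eq_square algebra_simps)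
  also have "?C\<^sup>2 + (?C * ?c - ?S * ?s)\<^sup>2 - 2 * ?C * (?C * ?c - ?S * ?s) * ?c
      = ?C\<^sup>2 - ?C\<^sup>2 * ?c\<^sup>2 + ?S\<^sup>2 * ?s\<^sup>2"
    by (simp add: power2_eq_square algebra_simps)
  also have "\<dots> = ?s\<^sup>2" unfolding pyth by (simp add: algebra_simps)
  finally have "?A \<bullet> ?A = 2 * ?s\<^sup>2" .
  then show ?thesis
    unfolding norm_eq_sqrt_inner using sin_edge_angle_pos[of k] by (simp add: real_sqrt_mult)
qed

lemma norm_traj_Suc_diff:
  "norm (traj (Suc k) - traj k) =
     sqrt 2 * sin (edge_angle (half_tan k)) / (cos (edge_pos k) * cos (edge_pos (Suc k)))"
proof -
  have "0 < cos (edge_pos k)" "0 < cos (edge_pos (Suc k))"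
    using cos_edge_pos[of k] cos_edge_pos[of "Suc k"] by linarith+
  then show ?thesis
    unfolding traj_Suc_diff norm_scaleR norm_chord by (simp add: divide_inverse_commute)
qed

lemma traj_Suc_neq: "traj (Suc k) \<noteq> traj k"
proof -
  have "0 < cos (edge_pos k)" "0 < cos (edge_pos (Suc k))"
    using cos_edge_pos[of k] cos_edge_pos[of "Suc k"] by linarith+
  then have "norm (traj (Suc k) - traj k) > 0"
    unfolding norm_traj_Suc_diff using sin_edge_angle_pos[of k] by simp
  then show ?thesis by auto
qed

lemma summable_traj: "summable (\<lambda>k. norm (traj (Suc k) - traj k))"
proof (rule summable_comparison_test')
  show "summable (\<lambda>k. 8 * half_tan k)" by (intro summable_mult summable_half_tan)
  fix k :: nat
  have c: "9/10 * (9/10) \<le> cos (edge_pos k) * cos (edge_pos (Suc k))"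
    using cos_edge_pos[of k] cos_edge_pos[of "Suc k"] by (intro mult_mono) auto
  have "sin (edge_angle (half_tan k)) \<le> edge_angle (half_tan k)"
    by (rule sin_x_le_x[OF edge_angle_bounds(1)])
  then have s: "sin (edge_angle (half_tan k)) \<le> 2 * half_tan k" using edge_angle_bounds(2)[of k] by linarith
  have "sqrt 2 \<le> 3/2" by (intro real_le_lsqrt) (auto simp: power2_eq_square)
  then have "sqrt 2 * sin (edge_angle (half_tan k)) / (cos (edge_pos k) * cos (edge_pos (Suc k)))
      \<le> 3/2 * (2 * half_tan k) / (9/10 * (9/10))"
    using s c sin_edge_angle_pos[of k] half_tan_pos[of k] by (intro frac_le mult_mono[of "sqrt 2" "3/2"]) auto
  also have "\<dots> \<le> 8 * half_tan k" using half_tan_pos[of k] by simp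
  finally show "norm (norm (traj (Suc k) - traj k)) \<le> 8 * half_tan k"
    unfolding norm_traj_Suc_diff[symmetric] by simp
qed

lemma velocity_traj:
  "billiard_velocity traj k = (1 / (sqrt 2 * sin (edge_angle (half_tan k)))) *\<^sub>R
     (cos (edge_pos k) *\<^sub>R node (Suc k) - cos (edge_pos (Suc k)) *\<^sub>R node k)"
proof -
  have "0 < cos (edge_pos k)" "0 < cos (edge_pos (Suc k))"
    using cos_edge_pos[of k] cos_edge_pos[of "Suc k"] by linarith+
  then show ?thesis
    unfolding billiard_velocity_def norm_traj_Suc_diff unfolding traj_Suc_diff
    using sin_edge_angle_pos[of k] by (simp add: field_simps)
qed

text \<open>Up to the factor \<open>sqrt 2\<close>, these are the unit tangent vectors, at a vertex of the spherical
  trajectory, of the edges towards the next and the previous vertex.\<close>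
lemma circ_shift:
  assumes "0 < t" "t < 1"
  shows "(1 / sin (edge_angle t)) *\<^sub>R (circ (\<phi> + base_angle t) - cos (edge_angle t) *\<^sub>R circ \<phi>)
          = (sqrt 2 * sqrt (1 - t\<^sup>2)) *\<^sub>R circ_tangent \<phi> - t *\<^sub>R circ_normal \<phi>" (is ?plus)
    and "(1 / sin (edge_angle t)) *\<^sub>R (circ (\<phi> - base_angle t) - cos (edge_angle t) *\<^sub>R circ \<phi>)
          = - (sqrt 2 * sqrt (1 - t\<^sup>2)) *\<^sub>R circ_tangent \<phi> - t *\<^sub>R circ_normal \<phi>" (is ?minus)
proof -
  define c where "c = cos (edge_angle t)"
  define s where "s = sin (edge_angle t)"
  define \<sigma> where "\<sigma> = sqrt 2 * sqrt (1 - t\<^sup>2)"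
  have s: "s > 0" "1 - c = t * s"
    using assms one_plus_square_pos[of t]
    unfolding s_def c_def edge_angle_def sin_double_arctan cos_double_arctan
    by (simp_all add: field_simps power2_eq_square)
  have b: "cos (base_angle t) = 2 * c - 1" "sin (base_angle t) = \<sigma> * s"
    using cos_base_angle[OF assms] sin_base_angle[OF assms] by (simp_all add: c_def s_def \<sigma>_def)
  have c: "c = 1 - t * s" using s(2) by simp
  have "circ (\<phi> + base_angle t) - c *\<^sub>R circ \<phi> = s *\<^sub>R (\<sigma> *\<^sub>R circ_tangent \<phi> - t *\<^sub>R circ_normal \<phi>)"
    unfolding circ_def circ_normal_def circ_tangent_def cos_add sin_add b c
    by (simp add: vec_eq_iff algebra_simps)
  then show ?plus using s(1) by (simp add: c_def s_def \<sigma>_def)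
  have "circ (\<phi> - base_angle t) - c *\<^sub>R circ \<phi> = s *\<^sub>R ((-\<sigma>) *\<^sub>R circ_tangent \<phi> - t *\<^sub>R circ_normal \<phi>)"
    unfolding circ_def circ_normal_def circ_tangent_def cos_diff sin_diff b c
    by (simp add: vec_eq_iff algebra_simps)
  then show ?minus using s(1) by (simp add: c_def s_def \<sigma>_def)
qed

text \<open>This is where the slope of \<open>g\<close> at the vertex is used: it turns the normal of the cone into the
  tilted direction.\<close>
lemma normal_node:
  "circ_normal (base_pos k) + tilt k *\<^sub>R circ_tangent (base_pos k)
     = ((cos (base_pos k) - tilt k * sin (base_pos k)) / cos (base_pos k)) *\<^sub>R cone_normal (node k)"
proof -
  let ?x = "cos (base_pos k)" and ?y = "sin (base_pos k)"
  have pos: "?x > 0" "?x - tilt k * ?y > 0"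
    using cos_base_pos[of k] tilt_denominator[of k] by linarith+
  define \<mu> where "\<mu> = (?x - tilt k * ?y) / ?x"
  have node: "node k \<bullet> node k = 2" "node k $ j = ?y"
    by (simp_all add: node_def circ_inner) (simp add: circ_def axis_nth)
  have "cone_normal (node k) = ?x *\<^sub>R axis i 1 + (?y + slope k) *\<^sub>R axis j 1 - (1 + slope k * ?y) *\<^sub>R axis l 1"
    unfolding cone_normal_def grad_def inner_add_left node g'_node
    by (simp add: inner_axis' node) (simp add: node_def circ_def algebra_simps scaleR_2)
  moreover have "\<mu> * ?x = ?x - tilt k * ?y" using pos by (simp add: \<mu>_def)
  moreover have \<mu>d: "\<mu> * slope k = tilt k / ?x" using pos by (simp add: \<mu>_def slope_def)
  moreover have "\<mu> * (?y + slope k) = ?y + tilt k * ?x"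
  proof -
    have "\<mu> * ?y + tilt k / ?x = (?x * ?y + tilt k * (1 - ?y\<^sup>2)) / ?x"
      using pos by (simp add: \<mu>_def field_simps power2_eq_square)
    also have "1 - ?y\<^sup>2 = ?x\<^sup>2" by (simp add: cos_squared_eq)
    also have "(?x * ?y + tilt k * ?x\<^sup>2) / ?x = ?y + tilt k * ?x"
      using pos by (simp add: field_simps power2_eq_square)
    finally show ?thesis by (simp add: distrib_left \<mu>d)
  qed
  moreover have "\<mu> * (1 + slope k * ?y) = 1"
  proof -
    have "\<mu> * (1 + slope k * ?y) = \<mu> + (\<mu> * slope k) * ?y" by (simp add: algebra_simps)
    also have "\<dots> = 1" unfolding \<mu>d using pos by (simp add: \<mu>_def field_simps)
    finally show ?thesis .
  qed
  ultimately have "\<mu> *\<^sub>R cone_normal (node k) = (?x - tilt k * ?y) *\<^sub>R axis i 1 + (?y + tilt k * ?x) *\<^sub>R axis j 1 - axis l 1"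
    by (simp add: scaleR_add_right scaleR_diff_right)
  also have "\<dots> = circ_normal (base_pos k) + tilt k *\<^sub>R circ_tangent (base_pos k)"
    by (simp add: circ_normal_def circ_tangent_def algebra_simps)
  finally show ?thesis by (simp add: \<mu>_def)
qed

text \<open>In the frame of the vertex both velocities have the same component along the ray, since
  it depends on \<open>edge_pos\<close> only. The jump is therefore a multiple of the sum of the two unit tangent vectors
  from \<open>circ_shift\<close>, and this sum has the direction \<open>circ_normal + tilt * circ_tangent\<close>, because
  \<open>\<rho>\<^sub>m\<^sup>2 - \<rho>\<^sub>k\<^sup>2 = T\<^sub>k\<^sup>2 - T\<^sub>m\<^sup>2\<close> for \<open>\<rho> = sqrt (1 - T\<^sup>2)\<close> and \<open>T = half_tan\<close>.\<close>
lemma velocity_jump: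
  obtains \<kappa> where "\<kappa> \<noteq> 0"
    "billiard_velocity traj (Suc k) - billiard_velocity traj k = \<kappa> *\<^sub>R cone_normal (node (Suc k))"
proof -
  let ?m = "Suc k"
  define \<phi> where "\<phi> = base_pos ?m"
  define C where "C = cos (edge_pos ?m)"
  define S where "S = sin (edge_pos ?m)"
  define s where "s k = sin (edge_angle (half_tan k))" for k
  define c where "c k = cos (edge_angle (half_tan k))" for k
  define \<rho> where "\<rho> k = sqrt (1 - (half_tan k)\<^sup>2)" for k
  note pos = sin_edge_angle_pos[folded s_def]
  have next_node: "(1 / s ?m) *\<^sub>R (node (Suc ?m) - c ?m *\<^sub>R node ?m)
      = (sqrt 2 * \<rho> ?m) *\<^sub>R circ_tangent \<phi> - half_tan ?m *\<^sub>R circ_normal \<phi>"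
    using circ_shift(1)[OF half_tan_pos half_tan_less_1, of ?m \<phi>]
    by (simp add: node_def \<phi>_def s_def c_def \<rho>_def base_pos_Suc)
  have prev_node: "(1 / s k) *\<^sub>R (node k - c k *\<^sub>R node ?m)
      = - (sqrt 2 * \<rho> k) *\<^sub>R circ_tangent \<phi> - half_tan k *\<^sub>R circ_normal \<phi>"
    using circ_shift(2)[OF half_tan_pos half_tan_less_1, of k \<phi>]
    by (simp add: node_def \<phi>_def s_def c_def \<rho>_def base_pos_Suc)
  have split: "(1 / (sqrt 2 * t)) *\<^sub>R (x + t *\<^sub>R y) = (1 / sqrt 2) *\<^sub>R ((1 / t) *\<^sub>R x + y)"
    if "t > 0" for t and x y :: "real^'n"
    using that by (simp add: scaleR_add_right)
  have next_cos: "cos (edge_pos (Suc ?m)) = C * c ?m - S * s ?m"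
    by (simp add: edge_pos_Suc[of ?m] cos_add C_def S_def s_def c_def)
  have next_split: "C *\<^sub>R node (Suc ?m) - cos (edge_pos (Suc ?m)) *\<^sub>R node ?m
      = C *\<^sub>R (node (Suc ?m) - c ?m *\<^sub>R node ?m) + s ?m *\<^sub>R (S *\<^sub>R node ?m)"
    unfolding next_cos by (simp add: algebra_simps)
  have out: "billiard_velocity traj ?m
      = (1 / sqrt 2) *\<^sub>R (C *\<^sub>R ((1 / s ?m) *\<^sub>R (node (Suc ?m) - c ?m *\<^sub>R node ?m)) + S *\<^sub>R node ?m)"
    unfolding velocity_traj C_def[symmetric] s_def[symmetric] next_split split[OF pos]
    by (simp only: scaleR_scaleR mult.commute)
  have "edge_pos k = edge_pos ?m - edge_angle (half_tan k)" by (simp add: edge_pos_Suc)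
  then have "cos (edge_pos k) = C * c k + S * s k"
    by (simp add: cos_diff C_def S_def s_def c_def)
  then have prev_split: "cos (edge_pos k) *\<^sub>R node ?m - C *\<^sub>R node k
      = (- C) *\<^sub>R (node k - c k *\<^sub>R node ?m) + s k *\<^sub>R (S *\<^sub>R node ?m)"
    by (simp add: algebra_simps)
  have inc: "billiard_velocity traj k
      = (1 / sqrt 2) *\<^sub>R ((- C) *\<^sub>R ((1 / s k) *\<^sub>R (node k - c k *\<^sub>R node ?m)) + S *\<^sub>R node ?m)"
    unfolding velocity_traj C_def[symmetric] s_def[symmetric] prev_split split[OF pos]
    by (simp only: scaleR_scaleR mult.commute)
  have "billiard_velocity traj ?m - billiard_velocity traj k
      = (1 / sqrt 2) *\<^sub>R (C *\<^sub>R ((1 / s ?m) *\<^sub>R (node (Suc ?m) - c ?m *\<^sub>R node ?m)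
                         + (1 / s k) *\<^sub>R (node k - c k *\<^sub>R node ?m)))"
    unfolding out inc by (simp add: scaleR_add_right scaleR_diff_right)
  also have "(1 / s ?m) *\<^sub>R (node (Suc ?m) - c ?m *\<^sub>R node ?m) + (1 / s k) *\<^sub>R (node k - c k *\<^sub>R node ?m)
      = (sqrt 2 * (\<rho> ?m - \<rho> k)) *\<^sub>R circ_tangent \<phi> - (half_tan ?m + half_tan k) *\<^sub>R circ_normal \<phi>"
    unfolding next_node prev_node by (simp add: algebra_simps)
  also have "sqrt 2 * (\<rho> ?m - \<rho> k) = - (half_tan ?m + half_tan k) * tilt ?m"
  proof -
    have r: "\<rho> ?m \<ge> 9/10" "\<rho> k \<ge> 9/10" unfolding \<rho>_def by (rule root_half_tan)+
    have "(\<rho> n)\<^sup>2 = 1 - (half_tan n)\<^sup>2" for n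
      using half_tan_less_1[of n] half_tan_pos[of n] by (simp add: \<rho>_def abs_square_le_1)
    then have "(\<rho> ?m - \<rho> k) * (\<rho> ?m + \<rho> k) = - ((half_tan ?m + half_tan k) * (half_tan ?m - half_tan k))"
      by (simp add: power2_eq_square algebra_simps)
    moreover have "\<rho> ?m + \<rho> k \<noteq> 0" using r by linarith
    ultimately have \<rho>_diff: "\<rho> ?m - \<rho> k = - ((half_tan ?m + half_tan k) * (half_tan ?m - half_tan k)) / (\<rho> ?m + \<rho> k)"
      by (metis eq_divide_imp)
    have tilt: "tilt ?m = sqrt 2 * (half_tan ?m - half_tan k) / (\<rho> ?m + \<rho> k)"
      by (simp add: tilt_def \<rho>_def)
    have "sqrt 2 * (- (a * b) / r) = - a * (sqrt 2 * b / r)" for a b r :: real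
      by simp
    then show ?thesis unfolding \<rho>_diff tilt .
  qed
  also have "(- (half_tan ?m + half_tan k) * tilt ?m) *\<^sub>R circ_tangent \<phi> - (half_tan ?m + half_tan k) *\<^sub>R circ_normal \<phi>
      = (- (half_tan ?m + half_tan k)) *\<^sub>R (circ_normal \<phi> + tilt ?m *\<^sub>R circ_tangent \<phi>)"
    by (simp add: algebra_simps)
  also have "\<dots> = (- (half_tan ?m + half_tan k)) *\<^sub>R
      ((cos \<phi> - tilt ?m * sin \<phi>) / cos \<phi>) *\<^sub>R cone_normal (node ?m)"
    unfolding \<phi>_def normal_node ..
  finally have "billiard_velocity traj ?m - billiard_velocity traj k
      = ((1 / sqrt 2) * C * (- (half_tan ?m + half_tan k)) * ((cos \<phi> - tilt ?m * sin \<phi>) / cos \<phi>)) *\<^sub>R cone_normal (node ?m)"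
    by simp
  moreover have "C > 0" "half_tan ?m + half_tan k > 0" "cos \<phi> > 0" "cos \<phi> - tilt ?m * sin \<phi> > 0"
    using cos_edge_pos[of ?m] half_tan_pos[of ?m] half_tan_pos[of k] cos_base_pos[of ?m] tilt_denominator[of ?m]
    unfolding C_def \<phi>_def by linarith+
  then have "(1 / sqrt 2) * C * (- (half_tan ?m + half_tan k)) * ((cos \<phi> - tilt ?m * sin \<phi>) / cos \<phi>) \<noteq> 0"
    by simp
  ultimately show ?thesis using that by blast
qed

lemma velocity_in_span:
  "\<exists>a b c. billiard_velocity traj k = a *\<^sub>R axis i 1 + b *\<^sub>R axis j 1 + c *\<^sub>R axis l 1"
proof -
  have span: "s *\<^sub>R (x *\<^sub>R circ \<phi> - y *\<^sub>R circ \<psi>) = (s * (x * cos \<phi> - y * cos \<psi>)) *\<^sub>R axis i 1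
      + (s * (x * sin \<phi> - y * sin \<psi>)) *\<^sub>R axis j 1 + (s * (x - y)) *\<^sub>R axis l 1" for s x y \<phi> \<psi>
    by (simp add: circ_def algebra_simps)
  show ?thesis unfolding velocity_traj node_def span by blast
qed

lemma norm_velocity: "norm (billiard_velocity traj k) = 1"
  using traj_Suc_neq[of k] by (simp add: billiard_velocity_def)

text \<open>Two unit vectors whose difference is normal to the tangent space have a sum orthogonal to that normal,
  hence are mirror images of each other.\<close>
lemma reflection_traj:
  "is_reflection_in (tangent_space cone_surface (traj (Suc k)))
     (billiard_velocity traj k) (billiard_velocity traj (Suc k))"
proof -
  let ?v = "billiard_velocity traj k" and ?v' = "billiard_velocity traj (Suc k)"
  let ?n = "cone_normal (node (Suc k))" and ?r = "inverse (cos (edge_pos (Suc k)))"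
  define u where "u = (1/2) *\<^sub>R (?v + ?v')"
  define w where "w = (1/2) *\<^sub>R (?v - ?v')"
  obtain \<kappa> where \<kappa>: "\<kappa> \<noteq> 0" "?v' - ?v = \<kappa> *\<^sub>R ?n" by (rule velocity_jump)
  have r: "?r > 0" using cos_edge_pos[of "Suc k"] by simp
  have "(?v' - ?v) \<bullet> (?v + ?v') = 0"
    using norm_velocity[of k] norm_velocity[of "Suc k"]
    by (simp add: norm_eq_1 inner_add_right inner_diff_left inner_commute[of ?v' ?v])
  then have nu: "?n \<bullet> u = 0" using \<kappa> by (simp add: u_def)
  obtain a b c a' b' c' where
    v: "?v = a *\<^sub>R axis i 1 + b *\<^sub>R axis j 1 + c *\<^sub>R axis l 1" and
    v': "?v' = a' *\<^sub>R axis i 1 + b' *\<^sub>R axis j 1 + c' *\<^sub>R axis l 1"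
    using velocity_in_span by meson
  have u: "u = ((a + a') / 2) *\<^sub>R axis i 1 + ((b + b') / 2) *\<^sub>R axis j 1 + ((c + c') / 2) *\<^sub>R axis l 1"
    unfolding u_def v v' by (simp add: algebra_simps add_divide_distrib)
  have x: "cos (base_pos (Suc k)) > 0" using cos_base_pos[of "Suc k"] by linarith
  have "u \<in> tangent_space cone_surface (?r *\<^sub>R node (Suc k))"
    by (rule tangent_coneI[OF ij il _ u node_in_\<gamma> x r nu])
       (simp_all add: node_def circ_def)
  moreover have "w \<in> (tangent_space cone_surface (?r *\<^sub>R node (Suc k)))\<^sup>\<bottom>"
  proof -
    have "?v - ?v' = (- \<kappa>) *\<^sub>R ?n" using \<kappa>(2) by (simp add: algebra_simps)
    then show ?thesis
      using tangent_cone_normal[OF node_in_\<gamma> r]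
      by (simp add: orthogonal_comp_def orthogonal_def w_def inner_commute[of _ ?n])
  qed
  moreover have "?v = u + w" "?v' = u - w"
    by (simp_all add: u_def w_def algebra_simps flip: scaleR_add_left)
  ultimately show ?thesis unfolding is_reflection_in_def traj_def by blast
qed

lemma billiard_trajectory_traj: "billiard_trajectory cone_surface traj"
  unfolding billiard_trajectory_def
proof (intro conjI allI)
  fix k
  have r: "inverse (cos (edge_pos m)) > 0" for m using cos_edge_pos[of m] by simp
  show "traj k \<in> cone_surface"
    using node_in_\<gamma> r unfolding traj_def cone_surface_def by blast
  show "traj (Suc k) \<noteq> traj k" by (rule traj_Suc_neq)
  have "node k $ j \<noteq> node (Suc k) $ j"
    using base_gap[of k] half_tan_pos[of k] by (simp add: node_def circ_def axis_nth)
  then have "node k \<noteq> node (Suc k)" by auto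
  then show "open_segment (traj k) (traj (Suc k)) \<subseteq> interior (convex hull cone_surface)"
    unfolding traj_def by (rule chord_in_interior_hull[OF node_in_\<gamma> node_in_\<gamma> _ r r])
  show "is_reflection_in (tangent_space cone_surface (traj (Suc k)))
     (billiard_velocity traj k) (billiard_velocity traj (Suc k))"
    by (rule reflection_traj)
qed

end

theorem theorem1:
  fixes l :: "'n::finite"
  assumes "CARD('n) \<ge> 3"
  shows "\<exists>(K :: (real^'n) set) (p :: nat \<Rightarrow> real^'n).
           C2_smooth_convex_cone l K \<and> billiard_trajectory K p \<and>
           summable (\<lambda>k. norm (p (Suc k) - p k))"
proof -
  obtain j where j: "j \<noteq> l"
  proof -
    have "card {l} < CARD('n)" using assms by simp
    then have "UNIV \<noteq> {l}" by (metis less_irrefl)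
    then show ?thesis using that by blast
  qed
  have "card {j, l} < CARD('n)" using assms j by simp
  then have "UNIV \<noteq> {j, l}" by (metis less_irrefl)
  then obtain i where i: "i \<noteq> j" "i \<noteq> l" by blast
  obtain g g' g'' :: "real \<Rightarrow> real" where g:
    "\<And>t. (g has_real_derivative g' t) (at t)"
    "\<And>t. (g' has_real_derivative g'' t) (at t)"
    "continuous_on UNIV g''"
    "\<And>t. \<bar>g t\<bar> \<le> 1/8" "\<And>t. \<bar>g' t\<bar> \<le> 1/4" "\<And>t. \<bar>g'' t\<bar> \<le> 1/2"
    "\<And>k. g (sin (base_pos k)) = 0" "\<And>k. g' (sin (base_pos k)) = slope k"
    using perturbation_exists by blast
  interpret billiard_table g g' g'' j l i
    by unfold_locales (fact j g i)+
  show ?thesis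
    using smooth_convex_cone billiard_trajectory_traj summable_traj by blast
qed

end
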